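(* The operator $\mathcal{L}_W : \mathcal{D}_W \to L^2(\mathbb{T})$ (defined in the context) enjoys the following properties. (a) $\mathcal{D}_W$ is dense in $L^2(\mathbb{T})$. (b) The operator $\mathbb{I} - \mathcal{L}_W : \mathcal{D}_W \to L^2(\mathbb{T})$ is bijective. (c) $\mathcal{L}_W : \mathcal{D}_W \to L^2(\mathbb{T})$ is self-adjoint and non-positive: $\langle -\mathcal{L}_W f, f\rangle \ge 0$ for all $f \in \mathcal{D}_W$. (d) $\mathcal{L}_W$ is dissipative. (e) The eigenvalues of the operator $-\mathcal{L}_W$ form a countable set $\{\lambda_n : n \ge 0\}$. All eigenvalues have finite multiplicity, $0 = \lambda_0 \le \lambda_1 \le \cdots$, and $\lim_{n\to\infty} \lambda_n = \infty$. (f) The eigenvectors $\{f_n\}$ of $-\mathcal{L}_W$ form a complete orthonormal system of $L^2(\mathbb{T})$.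
   Context: $\mathbb{T} = [0,1)$ is the one-dimensional torus, $\langle f, g\rangle = \int_{\mathbb{T}} f(u) g(u)\,du$ is the inner product of the real Hilbert space $L^2(\mathbb{T})$, $\|\cdot\|$ its norm, and $\mathbb{I}$ is the identity of $L^2(\mathbb{T})$. $W:\mathbb{R}\to\mathbb{R}$ is a fixed strictly increasing, right continuous with left limits function, periodic in the sense that $W(u+1)-W(u) = W(1)-W(0)$ for all $u\in\mathbb{R}$, and with $W(0)=0$. Integrals against $W(dy)$ are with respect to the Stieltjes measure of $W$. $\mathcal{D}_W$ is the set of functions $f$ in $L^2(\mathbb{T})$ such that $$f(x) = a + bW(x) + \int_{(0,x]} W(dy)\int_0^y \mathfrak{f}(z)\,dz$$ for some $a,b\in\mathbb{R}$ and some function $\mathfrak{f}$ in $L^2(\mathbb{T})$ such that $$\int_0^1 \mathfrak{f}(z)\,dz = 0,\qquad \int_{(0,1]} W(dy)\Big\{ b + \int_0^y \mathfrak{f}(z)\,dz\Big\} = 0.$$ The operator $\mathcal{L}_W:\mathcal{D}_W\to L^2(\mathbb{T})$ is defined by $\mathcal{L}_W f = \mathfrak{f}$. Dissipative means $\|\lambda g\| \le \|(\lambda\mathbb{I}-\mathcal{L}_W) g\|$ for all $g\in\mathcal{D}_W$ and $\lambda>0$. In (e) and (f) the eigenvalues are listed with multiplicity, $f_n$ being an eigenvector associated to $\lambda_n$. *)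

theory Defs
  imports "HOL-Analysis.Analysis"
begin

section \<open>The Hilbert space of square integrable functions on the torus\<close>

definition torus :: "real measure" where
  "torus = restrict_space lborel {0..<1}"

definition square_integrable :: "(real \<Rightarrow> real) \<Rightarrow> bool" where
  "square_integrable f \<longleftrightarrow> f \<in> borel_measurable torus \<and> integrable torus (\<lambda>x. (f x)\<^sup>2)"

definition L2_rel :: "(real \<Rightarrow> real) \<Rightarrow> (real \<Rightarrow> real) \<Rightarrow> bool" where
  "L2_rel f g \<longleftrightarrow> square_integrable f \<and> square_integrable g \<and> (AE x in torus. f x = g x)"

lemma square_integrable_mult:
  assumes "square_integrable f" "square_integrable g"
  shows "integrable torus (\<lambda>x. f x * g x)"
proof (rule Bochner_Integration.integrable_bound)
  show "integrable torus (\<lambda>x. (f x)\<^sup>2 + (g x)\<^sup>2)"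
    using assms by (simp add: square_integrable_def)
  show "(\<lambda>x. f x * g x) \<in> borel_measurable torus"
    using assms by (auto simp: square_integrable_def intro: borel_measurable_times)
  have "\<bar>a * b\<bar> \<le> a\<^sup>2 + b\<^sup>2" for a b :: real
    using sum_squares_bound[of a b] sum_squares_bound[of a "-b"] by (auto simp: abs_if)
  then show "AE x in torus. norm (f x * g x) \<le> norm ((f x)\<^sup>2 + (g x)\<^sup>2)"
    by simp
qed

lemma square_integrable_add:
  assumes "square_integrable f" "square_integrable g"
  shows "square_integrable (\<lambda>x. f x + g x)"
  using assms square_integrable_mult[OF assms]
  by (auto simp: square_integrable_def power2_sum mult.assoc)

lemma square_integrable_scale:
  "square_integrable f \<Longrightarrow> square_integrable (\<lambda>x. c * f x)"
  by (auto simp: square_integrable_def power_mult_distrib)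

lemma square_integrable_uminus:
  "square_integrable f \<Longrightarrow> square_integrable (\<lambda>x. - f x)"
  by (auto simp: square_integrable_def)

lemma square_integrable_diff:
  "square_integrable f \<Longrightarrow> square_integrable g \<Longrightarrow> square_integrable (\<lambda>x. f x - g x)"
  using square_integrable_add[OF _ square_integrable_uminus, of f g] by simp

lemma square_integrable_zero: "square_integrable (\<lambda>x. 0)"
  by (auto simp: square_integrable_def)

quotient_type torus_L2 = "real \<Rightarrow> real" / partial: L2_rel
proof (rule part_equivpI)
  show "\<exists>f. L2_rel f f"
    using square_integrable_zero by (auto simp: L2_rel_def)
  show "symp L2_rel"
    by (auto simp: symp_def L2_rel_def)
  show "transp L2_rel"
    unfolding transp_def L2_rel_def by (auto elim: AE_mp)
qed

instantiation torus_L2 :: real_vector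
begin

lift_definition zero_torus_L2 :: torus_L2 is "\<lambda>x. 0"
  by (auto simp: L2_rel_def square_integrable_zero)

lift_definition plus_torus_L2 :: "torus_L2 \<Rightarrow> torus_L2 \<Rightarrow> torus_L2" is "\<lambda>f g x. f x + g x"
  unfolding L2_rel_def by (auto intro: square_integrable_add)

lift_definition minus_torus_L2 :: "torus_L2 \<Rightarrow> torus_L2 \<Rightarrow> torus_L2" is "\<lambda>f g x. f x - g x"
  unfolding L2_rel_def by (auto intro: square_integrable_diff)

lift_definition uminus_torus_L2 :: "torus_L2 \<Rightarrow> torus_L2" is "\<lambda>f x. - f x"
  unfolding L2_rel_def by (auto intro: square_integrable_uminus)

lift_definition scaleR_torus_L2 :: "real \<Rightarrow> torus_L2 \<Rightarrow> torus_L2" is "\<lambda>c f x. c * f x"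
  unfolding L2_rel_def by (auto intro: square_integrable_scale)

instance
proof
  fix f g h :: torus_L2 and c d :: real
  show "f + g + h = f + (g + h)"
    by transfer (auto simp: L2_rel_def add.assoc intro!: square_integrable_add)
  show "f + g = g + f"
    by transfer (auto simp: L2_rel_def add.commute intro!: square_integrable_add)
  show "0 + f = f"
    by transfer (auto simp: L2_rel_def)
  show "- f + f = 0"
    by transfer (auto simp: L2_rel_def square_integrable_zero)
  show "f - g = f + - g"
    by transfer (auto simp: L2_rel_def intro!: square_integrable_diff)
  show "c *\<^sub>R (f + g) = c *\<^sub>R f + c *\<^sub>R g"
    by transfer (auto simp: L2_rel_def distrib_left
        intro!: square_integrable_add square_integrable_scale)
  show "(c + d) *\<^sub>R f = c *\<^sub>R f + d *\<^sub>R f"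
    by transfer (auto simp: L2_rel_def distrib_right
        intro!: square_integrable_add square_integrable_scale)
  show "c *\<^sub>R d *\<^sub>R f = (c * d) *\<^sub>R f"
    by transfer (auto simp: L2_rel_def mult.assoc
        intro!: square_integrable_scale)
  show "1 *\<^sub>R f = f"
    by transfer (auto simp: L2_rel_def)
qed

end

instantiation torus_L2 :: real_inner
begin

lift_definition inner_torus_L2 :: "torus_L2 \<Rightarrow> torus_L2 \<Rightarrow> real" is
  "\<lambda>f g. \<integral>x. f x * g x \<partial>torus"
proof -
  fix f f' g g' assume "L2_rel f f'" "L2_rel g g'"
  then show "(\<integral>x. f x * g x \<partial>torus) = (\<integral>x. f' x * g' x \<partial>torus)"
    by (intro integral_cong_AE) (auto simp: L2_rel_def square_integrable_def)
qed

definition norm_torus_L2 :: "torus_L2 \<Rightarrow> real" where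
  "norm_torus_L2 f = sqrt (inner f f)"

definition sgn_torus_L2 :: "torus_L2 \<Rightarrow> torus_L2" where
  "sgn_torus_L2 f = f /\<^sub>R norm f"

definition dist_torus_L2 :: "torus_L2 \<Rightarrow> torus_L2 \<Rightarrow> real" where
  "dist_torus_L2 f g = norm (f - g)"

definition uniformity_torus_L2 :: "(torus_L2 \<times> torus_L2) filter" where
  "uniformity_torus_L2 = (INF e\<in>{0<..}. principal {(f, g). dist f g < e})"

definition open_torus_L2 :: "torus_L2 set \<Rightarrow> bool" where
  "open_torus_L2 U \<longleftrightarrow> (\<forall>f\<in>U. \<forall>\<^sub>F (f', g) in uniformity. f' = f \<longrightarrow> g \<in> U)"

instance
proof
  fix f g h :: torus_L2 and c :: real
  show "dist f g = norm (f - g)" by (rule dist_torus_L2_def)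
  show "sgn f = f /\<^sub>R norm f" by (rule sgn_torus_L2_def)
  show "uniformity = (INF e\<in>{0<..}. principal {(f :: torus_L2, g). dist f g < e})"
    by (rule uniformity_torus_L2_def)
  show "open U \<longleftrightarrow> (\<forall>f\<in>U. \<forall>\<^sub>F (f', g) in uniformity. f' = f \<longrightarrow> g \<in> U)" for U :: "torus_L2 set"
    by (rule open_torus_L2_def)
  show "inner f g = inner g f"
    by transfer (simp add: mult.commute)
  show "inner (f + g) h = inner f h + inner g h"
    by transfer (auto simp: L2_rel_def distrib_right square_integrable_mult)
  show "inner (c *\<^sub>R f) g = c * inner f g"
    by transfer (auto simp: mult.assoc)
  show "0 \<le> inner f f"
    by transfer auto
  show "inner f f = 0 \<longleftrightarrow> f = 0"
  proof transfer
    fix f assume "L2_rel f f"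
    then show "(\<integral>x. f x * f x \<partial>torus) = 0 \<longleftrightarrow> L2_rel f (\<lambda>x. 0)"
      using integral_nonneg_eq_0_iff_AE[of torus "\<lambda>x. f x * f x"]
      by (auto simp: L2_rel_def square_integrable_mult square_integrable_zero)
  qed
  show "norm f = sqrt (inner f f)" by (rule norm_torus_L2_def)
qed

end


section \<open>Unbounded operators on a real inner product space\<close>

text \<open>An operator is a function \<open>A\<close> together with its domain \<open>D\<close>; values of \<open>A\<close> outside \<open>D\<close>
  are irrelevant.\<close>

text \<open>For a dense domain, \<open>adjoint_graph D A\<close> is the graph of the adjoint operator, so that
  \<open>self_adjoint\<close> is equality of \<open>A\<close> with its adjoint, domains included. (The graph of an adjoint
  is always a linear subspace, so this also forces \<open>D\<close> to be a subspace and \<open>A\<close> to be linear.)\<close>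

definition adjoint_graph :: "'a::real_inner set \<Rightarrow> ('a \<Rightarrow> 'a) \<Rightarrow> ('a \<times> 'a) set" where
  "adjoint_graph D A = {(g, h). \<forall>f\<in>D. inner (A f) g = inner f h}"

definition self_adjoint :: "'a::real_inner set \<Rightarrow> ('a \<Rightarrow> 'a) \<Rightarrow> bool" where
  "self_adjoint D A \<longleftrightarrow> closure D = UNIV \<and> adjoint_graph D A = {(f, A f) |f. f \<in> D}"

definition dissipative :: "'a::real_inner set \<Rightarrow> ('a \<Rightarrow> 'a) \<Rightarrow> bool" where
  "dissipative D A \<longleftrightarrow> (\<forall>g\<in>D. \<forall>c>0. norm (c *\<^sub>R g) \<le> norm (c *\<^sub>R g - A g))"

definition eigenspace :: "'a::real_vector set \<Rightarrow> ('a \<Rightarrow> 'a) \<Rightarrow> real \<Rightarrow> 'a set" where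
  "eigenspace D A c = {f \<in> D. A f = c *\<^sub>R f}"

definition eigenvalues :: "'a::real_vector set \<Rightarrow> ('a \<Rightarrow> 'a) \<Rightarrow> real set" where
  "eigenvalues D A = {c. \<exists>f\<in>eigenspace D A c. f \<noteq> 0}"

definition finite_dimensional :: "'a::real_vector set \<Rightarrow> bool" where
  "finite_dimensional V \<longleftrightarrow> (\<exists>B. finite B \<and> span B = V)"

definition orthonormal_seq :: "(nat \<Rightarrow> 'a::real_inner) \<Rightarrow> bool" where
  "orthonormal_seq f \<longleftrightarrow> (\<forall>m n. inner (f m) (f n) = (if m = n then 1 else 0))"

definition complete_orthonormal_seq :: "(nat \<Rightarrow> 'a::real_inner) \<Rightarrow> bool" where
  "complete_orthonormal_seq f \<longleftrightarrow> orthonormal_seq f \<and> closure (span (range f)) = UNIV"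


section \<open>The generalized derivative with respect to \<open>W\<close>\<close>

text \<open>\<open>interval_measure W\<close> is the Stieltjes measure, giving mass \<open>W b - W a\<close> to \<open>{a<..b}\<close>.
  The function \<open>rep_torus_L2 g\<close> is some representative of the class \<open>g\<close>, meaningful only on
  \<open>{0..<1}\<close> and up to null sets; this is all that the integrals below depend on.\<close>

definition primitive :: "torus_L2 \<Rightarrow> real \<Rightarrow> real" where
  "primitive g y = (LINT z:{0..<y}|lborel. rep_torus_L2 g z)"

definition LW_graph :: "(real \<Rightarrow> real) \<Rightarrow> torus_L2 \<Rightarrow> torus_L2 \<Rightarrow> bool" where
  "LW_graph W f g \<longleftrightarrow> (\<exists>a b.
     (AE x in torus. rep_torus_L2 f x =
        a + b * W x + (LINT y:{0<..x}|interval_measure W. primitive g y)) \<and>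
     primitive g 1 = 0 \<and>
     (LINT y:{0<..1}|interval_measure W. b + primitive g y) = 0)"

definition DW :: "(real \<Rightarrow> real) \<Rightarrow> torus_L2 set" where
  "DW W = {f. \<exists>g. LW_graph W f g}"

text \<open>For strictly increasing right continuous \<open>W\<close>, the class \<open>g\<close> is determined by \<open>f\<close>: the
  right-hand side in \<open>LW_graph\<close> is right continuous, hence determined everywhere on \<open>{0..<1}\<close>,
  and so is the continuous function \<open>y \<mapsto> b + primitive g y\<close>.\<close>

definition LW :: "(real \<Rightarrow> real) \<Rightarrow> torus_L2 \<Rightarrow> torus_L2" where
  "LW W f = (THE g. LW_graph W f g)"

end

theory Submission
  imports Defs "HOL-Complex_Analysis.Great_Picard"
begin

text \<open>
  Write \<open>P g\<close> for the primitive of \<open>g\<close> vanishing at \<open>0\<close>. The second boundary condition fixes the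
  constant \<open>b\<close>, so \<open>b + P g\<close> is the function \<open>v\<close> (\<open>velocity g\<close>) obtained from \<open>P g\<close> by
  subtracting its \<open>dW\<close>-mean. Hence the graph of the operator consists of the pairs
  \<open>(a + potential g, g)\<close> where \<open>g\<close> has mean zero and \<open>potential g\<close> is the \<open>dW\<close>-integral of \<open>v\<close>
  (\<open>LW_graph_iff\<close>). Fubini's theorem is an integration by parts and gives
  \<open>\<langle>g, potential h\<rangle> = - \<integral> v\<^sub>g v\<^sub>h dW\<close> for \<open>g\<close> of mean zero (\<open>inner_potential\<close>). This one identity
  shows that the operator is symmetric and nonpositive, and, because \<open>dW\<close> charges every interval,
  that \<open>g\<close> is determined by \<open>f\<close>.

  Two more facts are needed. By the Cauchy-Schwarz inequality primitives of bounded sequences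
  are uniformly Hoelder continuous, and \<open>potential g\<close> is controlled by the supremum of \<open>P g\<close>;
  so the Arzela-Ascoli theorem makes the embedding of the domain compact (\<open>potential_compact\<close>).
  And \<open>f - L f = h\<close> is solvable: on functions of mean zero it reads \<open>x + K x = h\<close> for
  \<open>x = - L f\<close> and the bounded nonnegative operator \<open>K\<close> that inverts \<open>-L\<close>, which the contraction
  principle solves
  (\<open>identity_plus_monotone_surj\<close>, \<open>LW_resolvent_exists\<close>).

  Everything else holds for an abstract symmetric nonpositive operator \<open>A\<close> on a Hilbert
  space such that \<open>I - A\<close> is onto and the domain embeds compactly. Surjectivity of \<open>I - A\<close>
  upgrades symmetry to self-adjointness. The resolvent \<open>(I - A)\<^sup>-\<^sup>1\<close> is a compact positive
  operator, so it has an orthonormal basis of eigenvectors with eigenvalues \<open>r n\<close> decreasing to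
  \<open>0\<close> (\<open>eigenbasis\<close>); they are eigenvectors of \<open>-A\<close> for \<open>1 / r n - 1\<close>
  (\<open>discrete_spectrum\<close>). In particular the domain contains a basis and is dense.
\<close>

section \<open>Monotone perturbations of the identity on a Hilbert space\<close>

text \<open>The equation is the fixed point equation of \<open>x \<mapsto> x - t (x + K x - h)\<close>, and monotonicity
  of \<open>K\<close> makes this map a contraction for small \<open>t\<close>.\<close>

lemma identity_plus_monotone_surj:
  fixes K :: "'a::{real_inner,complete_space} \<Rightarrow> 'a"
  assumes K: "bounded_linear K" and mono: "\<And>x. 0 \<le> inner (K x) x"
  shows "\<exists>x. x + K x = h"
proof -
  interpret K: bounded_linear K by fact
  obtain B where B: "\<And>x. norm (K x) \<le> norm x * B"
    using K.bounded by blast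
  \<comment> \<open>The squared Lipschitz constant is at most \<open>(1 - t)\<^sup>2 + t\<^sup>2 B\<^sup>2\<close>; this \<open>t\<close> minimizes it.\<close>
  define t where "t = 1 / (1 + B\<^sup>2)"
  have "1 + B\<^sup>2 > 0"
    by (simp add: add_pos_nonneg)
  then have t: "0 < t" "t \<le> 1" "t * (1 + B\<^sup>2) = 1"
    by (auto simp: t_def field_simps)
  define \<phi> where "\<phi> x = x - t *\<^sub>R (x + K x - h)" for x
  have contr: "dist (\<phi> x) (\<phi> y) \<le> sqrt (1 - t) * dist x y" for x y
  proof -
    define z where "z = x - y"
    have diff: "\<phi> x - \<phi> y = (1 - t) *\<^sub>R z - t *\<^sub>R K z"
      by (simp add: \<phi>_def z_def K.diff algebra_simps)
    have "(norm (K z))\<^sup>2 \<le> (norm z * B)\<^sup>2"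
      by (intro power_mono B) auto
    then have Kz: "t\<^sup>2 * (norm (K z))\<^sup>2 \<le> t\<^sup>2 * (B\<^sup>2 * (norm z)\<^sup>2)"
      by (intro mult_left_mono) (auto simp: power_mult_distrib mult.commute)
    have cross: "0 \<le> 2 * t * (1 - t) * inner (K z) z"
      using t mono[of z] by auto
    have "(norm ((1 - t) *\<^sub>R z - t *\<^sub>R K z))\<^sup>2
        = (1 - t)\<^sup>2 * (norm z)\<^sup>2 - 2 * t * (1 - t) * inner (K z) z + t\<^sup>2 * (norm (K z))\<^sup>2"
      by (simp add: power2_norm_eq_inner inner_diff inner_commute)
         (simp add: algebra_simps power2_eq_square)
    also have "\<dots> \<le> (1 - t)\<^sup>2 * (norm z)\<^sup>2 + t\<^sup>2 * (B\<^sup>2 * (norm z)\<^sup>2)"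
      using Kz cross by linarith
    also have "\<dots> = (1 - 2 * t + t * (t * (1 + B\<^sup>2))) * (norm z)\<^sup>2"
      by (simp add: power2_eq_square algebra_simps)
    also have "\<dots> = (1 - t) * (norm z)\<^sup>2"
      by (simp add: t)
    also have "\<dots> = (sqrt (1 - t) * norm z)\<^sup>2"
      using t by (simp add: power_mult_distrib)
    finally have "norm ((1 - t) *\<^sub>R z - t *\<^sub>R K z) \<le> sqrt (1 - t) * norm z"
      by (rule power2_le_imp_le) (use t in auto)
    then show ?thesis
      by (simp add: dist_norm diff z_def)
  qed
  have "\<exists>!x. \<phi> x = x"
    by (rule banach_fix_type[of "sqrt (1 - t)"]) (use t contr in auto)
  then obtain x where "\<phi> x = x" by blast
  then have "x + K x = h"
    using t by (simp add: \<phi>_def)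
  then show ?thesis ..
qed

section \<open>The spectral theorem for compact positive operators\<close>

text \<open>Compactness is stated through sequences; \<open>positive\<close> is strict, so \<open>T\<close> is injective and
  the eigenvectors found below span the whole space.\<close>

locale compact_positive_operator =
  fixes T :: "'a::{real_inner,complete_space} \<Rightarrow> 'a"
  assumes bounded_linear: "bounded_linear T"
    and symmetric: "inner (T x) y = inner x (T y)"
    and positive: "x \<noteq> 0 \<Longrightarrow> 0 < inner (T x) x"
    and compact: "bounded (range X) \<Longrightarrow>
      \<exists>r l. strict_mono (r :: nat \<Rightarrow> nat) \<and> (\<lambda>n. T (X (r n))) \<longlonglongrightarrow> l"
begin

sublocale bounded_linear T
  by (fact bounded_linear)

lemma nonneg: "0 \<le> inner (T x) x"
  using positive[of x] by (cases "x = 0") auto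

text \<open>This is the Cauchy-Schwarz inequality for the form \<open>\<langle>T x, y\<rangle>\<close> at \<open>y = T x\<close>, when \<open>r\<close> bounds
  the form at \<open>T x\<close>; it comes from the form being nonnegative at \<open>r x - T x\<close>.\<close>

lemma norm_image_le:
  assumes "0 < r" and "inner (T (T x)) (T x) \<le> r * (norm (T x))\<^sup>2"
  shows "(norm (T x))\<^sup>2 \<le> r * inner (T x) x"
proof -
  have "0 \<le> inner (T (r *\<^sub>R x - T x)) (r *\<^sub>R x - T x)"
    by (rule nonneg)
  also have "\<dots> = r * (r * inner (T x) x) - 2 * r * (norm (T x))\<^sup>2 + inner (T (T x)) (T x)"
    by (simp add: diff scale inner_diff symmetric power2_norm_eq_inner algebra_simps)
  also have "\<dots> \<le> r * (r * inner (T x) x) - r * (norm (T x))\<^sup>2"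
    using assms(2) by simp
  finally have "r * (norm (T x))\<^sup>2 \<le> r * (r * inner (T x) x)"
    by simp
  then show ?thesis
    using assms(1) by simp
qed

text \<open>On a closed invariant subspace the Rayleigh quotient attains its supremum \<open>r\<close>. For unit
  vectors \<open>X n\<close> whose quotients approach \<open>r\<close>, the inequality above forces \<open>T (X n) - r X n\<close> to
  tend to \<open>0\<close>; a convergent subsequence of \<open>T (X n)\<close> then makes \<open>X n\<close> converge, since \<open>r > 0\<close>.\<close>

lemma maximizer_exists:
  assumes V: "subspace V" "closed V" "\<And>x. x \<in> V \<Longrightarrow> T x \<in> V"
    and "x0 \<in> V" "x0 \<noteq> 0"
  obtains e where "e \<in> V" "norm e = 1" "T e = inner (T e) e *\<^sub>R e"
    "\<And>x. x \<in> V \<Longrightarrow> inner (T x) x \<le> inner (T e) e * (norm x)\<^sup>2"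
proof -
  define S where "S = {inner (T x) x | x. x \<in> V \<and> norm x = 1}"
  define r where "r = Sup S"
  obtain B where B: "\<And>x. norm (T x) \<le> norm x * B"
    using bounded by blast
  have bdd: "bdd_above S"
  proof (rule bdd_aboveI)
    fix s assume "s \<in> S"
    then obtain x where x: "norm x = 1" "s = inner (T x) x"
      by (auto simp: S_def)
    have "s \<le> norm (T x) * norm x"
      unfolding x(2) by (rule norm_cauchy_schwarz)
    also have "\<dots> \<le> B"
      using B[of x] x(1) by simp
    finally show "s \<le> B" .
  qed
  have le_r: "inner (T x) x \<le> r * (norm x)\<^sup>2" if "x \<in> V" for x
  proof (cases "x = 0")
    case False
    define y where "y = (1 / norm x) *\<^sub>R x"
    have y: "y \<in> V" "norm y = 1" and x: "x = norm x *\<^sub>R y"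
      using that False V by (auto simp: y_def subspace_scale)
    have "inner (T y) y \<le> r"
      unfolding r_def using y by (intro cSup_upper bdd) (auto simp: S_def)
    moreover have "inner (T x) x = (norm x)\<^sup>2 * inner (T y) y"
      by (subst (1 2) x) (simp add: scale power2_eq_square)
    ultimately show ?thesis
      by (simp add: mult.commute mult_right_mono)
  qed (simp add: zero)
  have r: "0 < r"
    using le_r[OF \<open>x0 \<in> V\<close>] positive[OF \<open>x0 \<noteq> 0\<close>] zero_less_mult_pos2[of r "(norm x0)\<^sup>2"] \<open>x0 \<noteq> 0\<close>
    by fastforce
  have "S \<noteq> {}"
  proof -
    have "(1 / norm x0) *\<^sub>R x0 \<in> V" "norm ((1 / norm x0) *\<^sub>R x0) = 1"
      using assms by (auto simp: subspace_scale)
    then show ?thesis by (force simp: S_def)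
  qed
  have "\<exists>x. x \<in> V \<and> norm x = 1 \<and> r - 1 / Suc n < inner (T x) x" for n
  proof -
    have "r - 1 / Suc n < Sup S"
      by (simp add: r_def)
    then obtain s where "s \<in> S" "r - 1 / Suc n < s"
      using less_cSup_iff[OF \<open>S \<noteq> {}\<close> bdd] by blast
    then show ?thesis by (auto simp: S_def)
  qed
  then obtain X where X: "\<And>n. X n \<in> V" "\<And>n. norm (X n) = 1"
      "\<And>n. r - 1 / Suc n < inner (T (X n)) (X n)"
    by metis
  have X_le: "inner (T (X n)) (X n) \<le> r" for n
    using le_r[OF X(1)[of n]] X(2)[of n] by simp
  have residual: "(norm (T (X n) - r *\<^sub>R X n))\<^sup>2 \<le> r * (1 / Suc n)" for n
  proof -
    have "(norm (T (X n)))\<^sup>2 \<le> r * inner (T (X n)) (X n)"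
      by (rule norm_image_le[OF r]) (rule le_r, rule V, rule X)
    moreover have "(norm (T (X n) - r *\<^sub>R X n))\<^sup>2
        = (norm (T (X n)))\<^sup>2 - 2 * r * inner (T (X n)) (X n) + r\<^sup>2 * (norm (X n))\<^sup>2"
      by (simp add: power2_norm_eq_inner inner_diff inner_commute)
         (simp add: algebra_simps power2_eq_square)
    ultimately have "(norm (T (X n) - r *\<^sub>R X n))\<^sup>2 \<le> r * (r - inner (T (X n)) (X n))"
      using X(2)[of n] by (simp add: algebra_simps power2_eq_square)
    also have "\<dots> \<le> r * (1 / Suc n)"
      using X(3)[of n] r by (intro mult_left_mono) auto
    finally show ?thesis .
  qed
  have lim0: "(\<lambda>n. T (X n) - r *\<^sub>R X n) \<longlonglongrightarrow> 0"
  proof -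
    have "(\<lambda>n. r * (1 / Suc n)) \<longlonglongrightarrow> r * 0"
      by (rule tendsto_mult[OF tendsto_const LIMSEQ_Suc[OF lim_1_over_n]])
    then have "(\<lambda>n. r * (1 / Suc n)) \<longlonglongrightarrow> 0"
      by simp
    then have "(\<lambda>n. (norm (T (X n) - r *\<^sub>R X n))\<^sup>2) \<longlonglongrightarrow> 0"
      by (rule Lim_null_comparison[rotated]) (use residual in simp)
    then have "(\<lambda>n. sqrt ((norm (T (X n) - r *\<^sub>R X n))\<^sup>2)) \<longlonglongrightarrow> sqrt 0"
      by (rule tendsto_real_sqrt)
    then show ?thesis
      by (simp add: tendsto_norm_zero_iff)
  qed
  have "bounded (range X)"
    using X(2) by (auto simp: bounded_iff)
  then obtain k l where k: "strict_mono (k :: nat \<Rightarrow> nat)" "(\<lambda>n. T (X (k n))) \<longlonglongrightarrow> l"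
    using compact by blast
  have lim0': "(\<lambda>n. T (X (k n)) - r *\<^sub>R X (k n)) \<longlonglongrightarrow> 0"
    using LIMSEQ_subseq_LIMSEQ[OF lim0 k(1)] by (simp add: o_def)
  define e where "e = (1 / r) *\<^sub>R l"
  have "(\<lambda>n. (1 / r) *\<^sub>R (T (X (k n)) - (T (X (k n)) - r *\<^sub>R X (k n)))) \<longlonglongrightarrow> (1 / r) *\<^sub>R (l - 0)"
    by (intro tendsto_intros k lim0')
  then have Xe: "(\<lambda>n. X (k n)) \<longlonglongrightarrow> e"
    using r by (simp add: e_def)
  have "e \<in> V"
    using closed_sequentially[OF V(2) _ Xe] X by blast
  moreover have "norm e = 1"
    using tendsto_norm[OF Xe] X(2) by (simp add: LIMSEQ_const_iff)
  moreover have "T e = l"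
    using LIMSEQ_unique[OF tendsto[OF Xe] k(2)] .
  then have Te: "T e = r *\<^sub>R e"
    using r by (simp add: e_def)
  moreover have "inner (T e) e = r"
    using \<open>norm e = 1\<close> by (simp add: Te power2_norm_eq_inner[symmetric])
  ultimately show ?thesis
    using le_r that by auto
qed

text \<open>Greedy choice: each \<open>e n\<close> maximizes the Rayleigh quotient on the orthogonal complement of its
  predecessors, which is never trivial in infinite dimension. The maxima \<open>r n\<close> tend to \<open>0\<close>
  because otherwise \<open>T (e n) = r n e n\<close> would stay uniformly separated, against compactness.
  A vector \<open>x\<close> orthogonal to all \<open>e n\<close> competes at every stage, so
  \<open>\<langle>T x, x\<rangle> \<le> r n \<parallel>x\<parallel>\<^sup>2\<close> for all \<open>n\<close>, whence \<open>x = 0\<close>.\<close>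

theorem eigenbasis:
  assumes infdim: "\<And>B :: 'a set. finite B \<Longrightarrow> span B \<noteq> UNIV"
  obtains e :: "nat \<Rightarrow> 'a" and r :: "nat \<Rightarrow> real"
  where "complete_orthonormal_seq e" "\<And>n. T (e n) = r n *\<^sub>R e n" "\<And>n. 0 < r n" "decseq r"
    "r \<longlonglongrightarrow> 0" "\<And>x. inner (T x) x \<le> r 0 * (norm x)\<^sup>2"
    "\<And>x. (\<And>n. inner x (e n) = 0) \<Longrightarrow> x = 0"
proof -
  define P where "P f n v \<longleftrightarrow> norm v = 1 \<and> (\<forall>i<n. inner v (f i) = 0) \<and> T v = inner (T v) v *\<^sub>R v
      \<and> (\<forall>x. (\<forall>i<n. inner x (f i) = 0) \<longrightarrow> inner (T x) x \<le> inner (T v) v * (norm x)\<^sup>2)"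
    for f and n :: nat and v :: 'a
  have "\<exists>e. \<forall>n. P e n (e n)"
  proof (rule dependent_wellorder_choice)
    show "P f n v = P g n v" if "\<And>i. i < n \<Longrightarrow> f i = g i" for v f g and n :: nat
      using that by (simp add: P_def)
  next
    fix n :: nat and f
    assume P: "\<And>i. i < n \<Longrightarrow> P f i (f i)"
    define V where "V = {x. \<forall>i<n. inner x (f i) = 0}"
    have "subspace V"
      by (auto simp: V_def subspace_def inner_add_left)
    moreover have "closed V"
    proof -
      have "V = (\<Inter>i\<in>{..<n}. {x. inner x (f i) = 0})"
        by (auto simp: V_def)
      then show ?thesis
        by (auto intro!: closed_INT closed_Collect_eq continuous_intros)
    qed
    moreover have "T x \<in> V" if "x \<in> V" for x
    proof -
      have "inner (T x) (f i) = 0" if "i < n" for i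
      proof -
        have "inner (T x) (f i) = inner x (T (f i))"
          by (rule symmetric)
        also have "T (f i) = inner (T (f i)) (f i) *\<^sub>R f i"
          using P[OF that] by (simp add: P_def)
        finally show ?thesis
          using \<open>x \<in> V\<close> that by (simp add: V_def)
      qed
      then show ?thesis by (simp add: V_def)
    qed
    moreover obtain x0 where "x0 \<in> V" "x0 \<noteq> 0"
    proof -
      have "finite (f ` {..<n})" by simp
      then obtain x where x: "x \<notin> span (f ` {..<n})"
        using infdim by blast
      define x0 where "x0 = x - (\<Sum>i<n. inner x (f i) *\<^sub>R f i)"
      have ortho: "inner (f i) (f j) = (if i = j then 1 else 0)" if "i < n" "j < n" for i j
        using P[OF that(1)] P[OF that(2)] that
        by (cases i j rule: linorder_cases)
          (auto simp: P_def inner_commute power2_norm_eq_inner[symmetric])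
      have "inner x0 (f j) = 0" if "j < n" for j
      proof -
        have "(\<Sum>i<n. inner x (f i) * inner (f i) (f j)) = (\<Sum>i<n. if i = j then inner x (f i) else 0)"
          using that by (intro sum.cong) (auto simp: ortho)
        also have "\<dots> = inner x (f j)"
          using that by simp
        finally show ?thesis
          by (simp add: x0_def inner_diff_left inner_sum_left)
      qed
      moreover have "x0 \<noteq> 0"
      proof
        assume "x0 = 0"
        then have "x = (\<Sum>i<n. inner x (f i) *\<^sub>R f i)"
          by (simp add: x0_def)
        also have "\<dots> \<in> span (f ` {..<n})"
          by (intro span_sum span_scale span_base) auto
        finally show False using x by blast
      qed
      ultimately show thesis by (intro that[of x0]) (auto simp: V_def)
    qed
    ultimately obtain v where "v \<in> V" "norm v = 1" "T v = inner (T v) v *\<^sub>R v"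
        "\<And>x. x \<in> V \<Longrightarrow> inner (T x) x \<le> inner (T v) v * (norm x)\<^sup>2"
      by (rule maximizer_exists) (assumption, rule that)
    then show "\<exists>v. P f n v"
      by (intro exI[of _ v]) (auto simp: P_def V_def)
  qed
  then obtain e where e: "\<And>n. P e n (e n)" by blast
  define r where "r n = inner (T (e n)) (e n)" for n
  have norm_e: "norm (e n) = 1" and eigen: "T (e n) = r n *\<^sub>R e n"
    and below: "\<And>i. i < n \<Longrightarrow> inner (e n) (e i) = 0"
    and max: "\<And>x. (\<And>i. i < n \<Longrightarrow> inner x (e i) = 0) \<Longrightarrow> inner (T x) x \<le> r n * (norm x)\<^sup>2" for n
    using e[of n] by (simp_all add: P_def r_def)
  have ortho: "inner (e m) (e n) = (if m = n then 1 else 0)" for m n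
    by (metis below inner_commute norm_e norm_eq_1 nat_neq_iff)
  have r_pos: "0 < r n" for n
  proof -
    have "e n \<noteq> 0" using norm_e[of n] by auto
    then show ?thesis by (simp add: r_def positive)
  qed
  have "decseq r"
  proof (rule decseq_SucI)
    fix n
    have "inner (T (e (Suc n))) (e (Suc n)) \<le> r n * (norm (e (Suc n)))\<^sup>2"
      by (rule max) (simp add: ortho)
    then show "r (Suc n) \<le> r n"
      by (simp add: norm_e r_def)
  qed
  have r_lim: "r \<longlonglongrightarrow> 0"
  proof -
    obtain d where d: "r \<longlonglongrightarrow> d" "\<And>n. d \<le> r n"
      using decseq_convergent[OF \<open>decseq r\<close>, of 0] r_pos less_imp_le by metis
    have "0 \<le> d"
      using LIMSEQ_le_const[OF d(1), of 0] less_imp_le[OF r_pos] by blast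
    have "\<not> 0 < d"
    proof
      assume "0 < d"
      have "bounded (range e)"
        by (auto simp: bounded_iff norm_e)
      then obtain k l where k: "strict_mono (k :: nat \<Rightarrow> nat)" "(\<lambda>n. T (e (k n))) \<longlonglongrightarrow> l"
        using compact by blast
      have "Cauchy (\<lambda>n. T (e (k n)))"
        using k(2) by (rule LIMSEQ_imp_Cauchy)
      then obtain N where N: "\<And>m n. m \<ge> N \<Longrightarrow> n \<ge> N \<Longrightarrow> dist (T (e (k m))) (T (e (k n))) < d"
        using \<open>0 < d\<close> unfolding Cauchy_def by blast
      define i j where "i = k N" and "j = k (Suc N)"
      have "i \<noteq> j"
        using strict_monoD[OF k(1), of N "Suc N"] by (simp add: i_def j_def)
      have "(norm (T (e i) - T (e j)))\<^sup>2 = (r i)\<^sup>2 + (r j)\<^sup>2"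
        using \<open>i \<noteq> j\<close> by (simp add: eigen power2_norm_eq_inner inner_diff ortho) (simp add: power2_eq_square)
      also have "\<dots> \<ge> d\<^sup>2"
        using power_mono[OF d(2)[of i] \<open>0 \<le> d\<close>, of 2] by (simp add: add_increasing2)
      finally have "d \<le> norm (T (e i) - T (e j))"
        by (rule power2_le_imp_le) simp
      then show False
        using N[of N "Suc N"] by (simp add: i_def j_def dist_norm)
    qed
    with \<open>0 \<le> d\<close> d(1) show ?thesis by simp
  qed
  have total: "x = 0" if "\<And>n. inner x (e n) = 0" for x
  proof (rule ccontr)
    assume "x \<noteq> 0"
    have "inner (T x) x \<le> r n * (norm x)\<^sup>2" for n
      by (rule max) (rule that)
    moreover have "(\<lambda>n. r n * (norm x)\<^sup>2) \<longlonglongrightarrow> 0 * (norm x)\<^sup>2"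
      by (intro tendsto_intros r_lim)
    ultimately have "inner (T x) x \<le> 0"
      by (intro LIMSEQ_le_const[of _ 0]) auto
    with positive[OF \<open>x \<noteq> 0\<close>] show False by simp
  qed
  \<comment> \<open>The Fourier partial sums \<open>s n\<close> are Cauchy because \<open>\<parallel>h - s n\<parallel>\<^sup>2\<close> decreases and, by Pythagoras,
    its decrements are the squared distances between the \<open>s n\<close>; the limit has the same Fourier
    coefficients as \<open>h\<close>.\<close>
  have "h \<in> closure (span (range e))" for h
  proof -
    define s where "s n = (\<Sum>i<n. inner h (e i) *\<^sub>R e i)" for n
    have coeff: "inner (h - s n) (e j) = 0" if "j < n" for n j
    proof -
      have "inner (s n) (e j) = (\<Sum>i<n. if i = j then inner h (e i) else 0)"
        unfolding s_def inner_sum_left by (intro sum.cong) (auto simp: ortho)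
      then show ?thesis using that by (simp add: inner_diff_left)
    qed
    have ortho_s: "inner (h - s n) (s m) = 0" if "m \<le> n" for m n
      using that coeff[of _ n] by (simp add: s_def[of m] inner_sum_right)
    have pyth: "(norm (h - s m))\<^sup>2 = (norm (h - s n))\<^sup>2 + (norm (s n - s m))\<^sup>2" if "m \<le> n" for m n
    proof -
      have "inner (h - s n) (s n - s m) = 0"
        using ortho_s[OF that] ortho_s[of n n] by (simp add: inner_diff_right)
      moreover have "h - s m = (h - s n) + (s n - s m)" by simp
      ultimately show ?thesis
        by (metis norm_add_Pythagorean orthogonal_def)
    qed
    define q where "q n = (norm (h - s n))\<^sup>2" for n
    have "decseq q"
      using pyth by (auto simp: q_def decseq_def)
    then have "convergent q"
      by (rule decseq_convergent[of q 0]) (auto simp: q_def convergent_def)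
    then have "Cauchy q" by (rule convergent_Cauchy)
    have "Cauchy s"
    proof (rule metric_CauchyI)
      fix \<epsilon> :: real assume "0 < \<epsilon>"
      then obtain M where M: "\<And>m n. m \<ge> M \<Longrightarrow> n \<ge> M \<Longrightarrow> dist (q m) (q n) < \<epsilon>\<^sup>2"
        using \<open>Cauchy q\<close> unfolding Cauchy_def by (metis zero_less_power)
      have "dist (s m) (s n) < \<epsilon>" if "m \<ge> M" "n \<ge> M" "m \<le> n" for m n
      proof -
        have "(norm (s n - s m))\<^sup>2 = q m - q n"
          using pyth[OF \<open>m \<le> n\<close>] by (simp add: q_def)
        also have "\<dots> < \<epsilon>\<^sup>2"
          using M[OF that(1,2)] by (simp add: dist_real_def)
        finally show ?thesis
          using \<open>0 < \<epsilon>\<close> by (simp add: dist_norm norm_minus_commute power_less_imp_less_base)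
      qed
      then show "\<exists>M. \<forall>m\<ge>M. \<forall>n\<ge>M. dist (s m) (s n) < \<epsilon>"
        by (metis dist_commute linorder_le_cases)
    qed
    then obtain l where l: "s \<longlonglongrightarrow> l"
      using Cauchy_convergent convergentD by blast
    have "inner (h - l) (e j) = 0" for j
    proof -
      have "(\<lambda>n. inner (h - s n) (e j)) \<longlonglongrightarrow> inner (h - l) (e j)"
        by (intro tendsto_intros l)
      moreover have "(\<lambda>n. inner (h - s n) (e j)) \<longlonglongrightarrow> 0"
        by (rule tendsto_eventually) (rule eventually_mono[OF eventually_gt_at_top[of j] coeff])
      ultimately show ?thesis
        by (rule LIMSEQ_unique)
    qed
    then have "h = l"
      using total[of "h - l"] by simp
    moreover have "s n \<in> span (range e)" for n
      unfolding s_def by (intro span_sum span_scale span_base) auto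
    ultimately show ?thesis
      using l closure_sequential by blast
  qed
  then have "complete_orthonormal_seq e"
    by (auto simp: complete_orthonormal_seq_def orthonormal_seq_def ortho)
  moreover have "inner (T x) x \<le> r 0 * (norm x)\<^sup>2" for x
    by (rule max) simp
  ultimately show ?thesis
    using that eigen r_pos \<open>decseq r\<close> r_lim total by blast
qed

end

section \<open>Nonpositive symmetric operators with compact resolvent\<close>

text \<open>The assumption \<open>compact\<close> says that sets bounded in the graph norm are relatively compact in
  the ambient space.\<close>

locale nonpositive_operator_compact_resolvent =
  fixes D :: "'a::{real_inner,complete_space} set" and A :: "'a \<Rightarrow> 'a"
  assumes subspace: "subspace D"
    and add: "f \<in> D \<Longrightarrow> g \<in> D \<Longrightarrow> A (f + g) = A f + A g"
    and scale: "f \<in> D \<Longrightarrow> A (c *\<^sub>R f) = c *\<^sub>R A f"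
    and symmetric: "f \<in> D \<Longrightarrow> g \<in> D \<Longrightarrow> inner (A f) g = inner f (A g)"
    and nonpositive: "f \<in> D \<Longrightarrow> 0 \<le> inner (- A f) f"
    and resolvent_exists: "\<exists>f\<in>D. f - A f = h"
    and compact: "(\<And>n. X n \<in> D) \<Longrightarrow> bounded (range X) \<Longrightarrow> bounded (range (\<lambda>n. A (X n))) \<Longrightarrow>
      \<exists>r l. strict_mono (r :: nat \<Rightarrow> nat) \<and> (\<lambda>n. X (r n)) \<longlonglongrightarrow> l"
begin

lemma diff: "f \<in> D \<Longrightarrow> g \<in> D \<Longrightarrow> A (f - g) = A f - A g"
  using add[of f "- g"] scale[of g "-1"] subspace_neg[OF subspace, of g] by simp

lemma dissipative_operator: "dissipative D A"
  unfolding dissipative_def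
proof (intro ballI allI impI)
  fix g and c :: real assume "g \<in> D" "0 < c"
  have "0 \<le> 2 * c * inner (- A g) g"
    using nonpositive[OF \<open>g \<in> D\<close>] \<open>0 < c\<close> by (intro mult_nonneg_nonneg) auto
  then have "(norm (c *\<^sub>R g))\<^sup>2 \<le> (norm (c *\<^sub>R g))\<^sup>2 + 2 * c * inner (- A g) g + (norm (A g))\<^sup>2"
    using zero_le_power2[of "norm (A g)"] by linarith
  also have "\<dots> = (norm (c *\<^sub>R g - A g))\<^sup>2"
    unfolding power2_norm_eq_inner by (simp add: inner_diff inner_commute)
  finally show "norm (c *\<^sub>R g) \<le> norm (c *\<^sub>R g - A g)"
    by (rule power2_le_imp_le) simp
qed

lemma norm_le_resolvent: "f \<in> D \<Longrightarrow> norm f \<le> norm (f - A f)"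
  using dissipative_operator by (force simp: dissipative_def dest: spec[of _ 1])

lemma resolvent_inj: "inj_on (\<lambda>f. f - A f) D"
proof (rule inj_onI)
  fix f g assume "f \<in> D" "g \<in> D" "f - A f = g - A g"
  then have "norm (f - g) \<le> 0"
    using norm_le_resolvent[OF subspace_diff[OF subspace, of f g]] by (simp add: diff algebra_simps)
  then show "f = g" by simp
qed

lemma range_identity_minus: "(\<lambda>f. f - A f) ` D = UNIV"
proof -
  have "h \<in> (\<lambda>f. f - A f) ` D" for h
    using resolvent_exists[of h] by auto
  then show ?thesis by blast
qed

lemma resolvent_bij: "bij_betw (\<lambda>f. f - A f) D UNIV"
  unfolding bij_betw_def using resolvent_inj range_identity_minus by blast

definition resolvent :: "'a \<Rightarrow> 'a" where
  "resolvent = the_inv_into D (\<lambda>f. f - A f)"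

lemma resolvent_in: "resolvent h \<in> D"
  unfolding resolvent_def
  by (rule the_inv_into_into[OF resolvent_inj]) (simp_all add: range_identity_minus)

lemma resolvent_eq: "resolvent h - A (resolvent h) = h"
  unfolding resolvent_def
  by (rule f_the_inv_into_f[OF resolvent_inj]) (simp add: range_identity_minus)

lemma resolvent_unique: "f \<in> D \<Longrightarrow> f - A f = h \<Longrightarrow> resolvent h = f"
  using resolvent_inj resolvent_in resolvent_eq by (auto simp: inj_on_def)

lemma norm_resolvent_le: "norm (resolvent h) \<le> norm h"
  using norm_le_resolvent[OF resolvent_in, of h] by (simp add: resolvent_eq)

sublocale resolvent: compact_positive_operator resolvent
proof
  show "resolvent (x + y) = resolvent x + resolvent y" for x y
  proof (rule resolvent_unique)
    show "resolvent x + resolvent y \<in> D" by (intro subspace_add subspace resolvent_in)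
    show "resolvent x + resolvent y - A (resolvent x + resolvent y) = x + y"
    proof -
      have "resolvent x + resolvent y - A (resolvent x + resolvent y) = (resolvent x - A (resolvent x)) + (resolvent y - A (resolvent y))"
        by (simp add: add resolvent_in)
      then show ?thesis by (simp add: resolvent_eq)
    qed
  qed
  show "resolvent (c *\<^sub>R x) = c *\<^sub>R resolvent x" for c x
  proof (rule resolvent_unique)
    show "c *\<^sub>R resolvent x \<in> D" by (intro subspace_scale subspace resolvent_in)
    show "c *\<^sub>R resolvent x - A (c *\<^sub>R resolvent x) = c *\<^sub>R x"
      using resolvent_eq[of x] by (simp add: scale resolvent_in flip: scaleR_diff_right)
  qed
  show "\<exists>K. \<forall>x. norm (resolvent x) \<le> norm x * K"
    using norm_resolvent_le by (intro exI[of _ 1]) simp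
  show "inner (resolvent x) y = inner x (resolvent y)" for x y
  proof -
    have "inner (resolvent x) y = inner (resolvent x) (resolvent y - A (resolvent y))" by (simp add: resolvent_eq)
    also have "\<dots> = inner (resolvent x - A (resolvent x)) (resolvent y)"
      by (simp add: inner_diff symmetric resolvent_in)
    finally show ?thesis by (simp add: resolvent_eq)
  qed
  show "0 < inner (resolvent x) x" if "x \<noteq> 0" for x
  proof -
    have "resolvent x \<noteq> 0"
      using resolvent_eq[of x] scale[OF resolvent_in, of 0 x] that by auto
    have "inner (resolvent x) x = inner (resolvent x) (resolvent x - A (resolvent x))" by (simp add: resolvent_eq)
    also have "\<dots> = (norm (resolvent x))\<^sup>2 + inner (- A (resolvent x)) (resolvent x)"
      by (simp add: inner_diff inner_commute power2_norm_eq_inner)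
    also have "\<dots> > 0"
      using \<open>resolvent x \<noteq> 0\<close> nonpositive[OF resolvent_in[of x]] by (intro add_pos_nonneg) auto
    finally show ?thesis .
  qed
  show "\<exists>r l. strict_mono r \<and> (\<lambda>n. resolvent (X (r n))) \<longlonglongrightarrow> l" if bdd: "bounded (range X)" for X :: "nat \<Rightarrow> 'a"
  proof -
    obtain B where B: "\<And>n. norm (X n) \<le> B"
      using bdd unfolding bounded_iff by blast
    have "norm (resolvent (X n)) \<le> B" for n
      using norm_resolvent_le[of "X n"] B[of n] by linarith
    moreover have "norm (A (resolvent (X n))) \<le> B + B" for n
    proof -
      have "A (resolvent (X n)) = resolvent (X n) - X n"
        using resolvent_eq[of "X n"] by (simp add: algebra_simps)
      then show ?thesis
        using norm_triangle_ineq4[of "resolvent (X n)" "X n"] calculation[of n] B[of n] by simp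
    qed
    ultimately have "bounded (range (\<lambda>n. resolvent (X n)))" "bounded (range (\<lambda>n. A (resolvent (X n))))"
      by (auto simp: bounded_iff)
    then show ?thesis
      using compact[OF resolvent_in] by blast
  qed
qed

text \<open>If \<open>(g, h)\<close> lies in the adjoint graph and \<open>g'\<close> solves \<open>g' - A g' = g - h\<close>, then \<open>g - g'\<close> is
  orthogonal to the range of \<open>I - A\<close>, which is everything; so \<open>g = g'\<close> is in the domain.\<close>

lemma self_adjoint_operator:
  assumes dense: "closure D = UNIV"
  shows "self_adjoint D A"
proof -
  have "g \<in> D \<and> h = A g" if gh: "\<And>f. f \<in> D \<Longrightarrow> inner (A f) g = inner f h" for g h
  proof -
    define g' where "g' = resolvent (g - h)"
    have g': "g' \<in> D" "g' - A g' = g - h"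
      by (simp_all add: g'_def resolvent_in resolvent_eq)
    have "inner x (g - g') = 0" for x
    proof -
      have "inner x g = inner (resolvent x - A (resolvent x)) g" by (simp add: resolvent_eq)
      also have "\<dots> = inner (resolvent x) (g - h)"
        by (simp add: inner_diff gh resolvent_in)
      also have "\<dots> = inner (resolvent x - A (resolvent x)) g'"
        using g' by (simp add: inner_diff symmetric resolvent_in flip: g'(2))
      finally show ?thesis by (simp add: resolvent_eq inner_diff)
    qed
    then have "g = g'"
      using inner_eq_zero_iff[of "g - g'"] by simp
    then show ?thesis using g' by simp
  qed
  then have "adjoint_graph D A \<subseteq> {(f, A f) | f. f \<in> D}"
    unfolding adjoint_graph_def by blast
  moreover have "{(f, A f) | f. f \<in> D} \<subseteq> adjoint_graph D A"
    using symmetric unfolding adjoint_graph_def by blast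
  ultimately show ?thesis
    using dense unfolding self_adjoint_def by blast
qed

text \<open>The kernel vector \<open>u\<close> is fixed by the resolvent, which has norm at most \<open>1\<close>; so the largest
  eigenvalue \<open>r 0\<close> of the resolvent is \<open>1\<close> and \<open>lam 0 = 0\<close>. Symmetry makes an eigenvector
  orthogonal to every \<open>e n\<close> with another eigenvalue, and completeness of the basis then leaves
  no further eigenvalues and spans each eigenspace by the \<open>e n\<close> in it.\<close>

theorem discrete_spectrum:
  assumes infdim: "\<And>B :: 'a set. finite B \<Longrightarrow> span B \<noteq> UNIV"
    and kernel: "u \<in> D" "u \<noteq> 0" "A u = 0"
  obtains lam :: "nat \<Rightarrow> real" and e :: "nat \<Rightarrow> 'a"
  where "complete_orthonormal_seq e"
    "\<And>n. e n \<in> eigenspace D (\<lambda>f. - A f) (lam n)"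
    "eigenvalues D (\<lambda>f. - A f) = range lam"
    "\<And>c. finite_dimensional (eigenspace D (\<lambda>f. - A f) c)"
    "\<And>c. card {n. lam n = c} = dim (eigenspace D (\<lambda>f. - A f) c)"
    "lam 0 = 0" "incseq lam" "filterlim lam at_top sequentially"
proof -
  obtain e :: "nat \<Rightarrow> 'a" and r where
    complete: "complete_orthonormal_seq e" and resolvent_e: "\<And>n. resolvent (e n) = r n *\<^sub>R e n"
    and r_pos: "\<And>n. 0 < r n" and "decseq r" "r \<longlonglongrightarrow> 0"
    and r0: "\<And>x. inner (resolvent x) x \<le> r 0 * (norm x)\<^sup>2"
    and total: "\<And>x. (\<And>n. inner x (e n) = 0) \<Longrightarrow> x = 0"
    by (rule resolvent.eigenbasis[OF infdim]) blast+
  have ortho: "inner (e m) (e n) = (if m = n then 1 else 0)" for m n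
    using complete by (simp add: complete_orthonormal_seq_def orthonormal_seq_def)
  define lam where "lam n = 1 / r n - 1" for n
  have e_D: "e n \<in> D" for n
  proof -
    have "e n = (1 / r n) *\<^sub>R resolvent (e n)"
      using r_pos[of n] by (simp add: resolvent_e)
    then show ?thesis
      using subspace_scale[OF subspace resolvent_in] by metis
  qed
  have Ae: "- A (e n) = lam n *\<^sub>R e n" for n
  proof -
    have "r n *\<^sub>R e n - A (r n *\<^sub>R e n) = e n"
      using resolvent_eq[of "e n"] by (simp add: resolvent_e)
    then have "r n *\<^sub>R (- A (e n)) = (1 - r n) *\<^sub>R e n"
      by (simp add: scale e_D algebra_simps)
    then have "(1 / r n) *\<^sub>R r n *\<^sub>R (- A (e n)) = (1 / r n) *\<^sub>R (1 - r n) *\<^sub>R e n"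
      by simp
    then show ?thesis
      using r_pos[of n] by (simp add: lam_def diff_divide_distrib)
  qed
  have eigen: "e n \<in> eigenspace D (\<lambda>f. - A f) (lam n)" for n
    using e_D Ae by (simp add: eigenspace_def)
  have "r 0 = 1"
  proof (rule antisym)
    have "inner (resolvent (e 0)) (e 0) \<le> norm (resolvent (e 0)) * norm (e 0)"
      by (rule norm_cauchy_schwarz)
    also have "\<dots> \<le> 1"
      using norm_resolvent_le[of "e 0"] ortho[of 0 0] by (simp add: norm_eq_1[THEN iffD2])
    finally show "r 0 \<le> 1"
      by (simp add: resolvent_e ortho)
    have "resolvent u = u"
      using kernel by (intro resolvent_unique) auto
    then have "1 * (norm u)\<^sup>2 \<le> r 0 * (norm u)\<^sup>2"
      using r0[of u] by (simp add: power2_norm_eq_inner)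
    then show "1 \<le> r 0"
      using kernel(2) by (simp del: mult_1)
  qed
  then have lam0: "lam 0 = 0" by (simp add: lam_def)
  have lam_mono: "incseq lam"
    using \<open>decseq r\<close> r_pos by (auto simp: lam_def incseq_def decseq_def intro!: divide_left_mono)
  have lam_lim: "filterlim lam at_top sequentially"
  proof -
    have "filterlim r (at_right 0) sequentially"
      using \<open>r \<longlonglongrightarrow> 0\<close> r_pos by (auto simp: filterlim_at less_imp_neq[symmetric])
    then have "filterlim (\<lambda>n. inverse (r n)) at_top sequentially"
      by (rule filterlim_compose[OF filterlim_inverse_at_top_right])
    then show ?thesis
      using filterlim_tendsto_add_at_top[OF tendsto_const[of "-1"]]
      by (simp add: lam_def[abs_def] inverse_eq_divide add.commute)
  qed
  have fin: "finite {n. lam n = c}" for c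
  proof -
    obtain N where "\<And>n. n \<ge> N \<Longrightarrow> c + 1 \<le> lam n"
      using lam_lim by (auto simp: filterlim_at_top eventually_sequentially)
    then have "{n. lam n = c} \<subseteq> {..<N}"
      by (force simp: not_le[symmetric])
    then show ?thesis by (rule finite_subset) simp
  qed
  have inj_e: "inj e"
    using ortho by (metis injI zero_neq_one)
  have orthogonal_to_others: "inner f (e n) = 0"
    if "f \<in> eigenspace D (\<lambda>f. - A f) c" "lam n \<noteq> c" for f c n
  proof -
    have f: "f \<in> D" "- A f = c *\<^sub>R f"
      using that(1) by (auto simp: eigenspace_def)
    have "c * inner f (e n) = inner (- A f) (e n)" by (simp add: f)
    also have "\<dots> = inner f (- A (e n))"
      using symmetric[OF f(1) e_D] by simp
    also have "\<dots> = lam n * inner f (e n)" by (simp add: Ae)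
    finally show ?thesis using that(2) by simp
  qed
  have space: "eigenspace D (\<lambda>f. - A f) c = span (e ` {n. lam n = c})" for c
  proof
    have "subspace (eigenspace D (\<lambda>f. - A f) c)"
      unfolding subspace_def eigenspace_def
      using subspace scale[of 0 0]
      by (auto simp: subspace_def add scale scaleR_add_right minus_add_distrib simp flip: scaleR_minus_right)
    then show "span (e ` {n. lam n = c}) \<subseteq> eigenspace D (\<lambda>f. - A f) c"
      using eigen by (intro span_minimal) auto
    show "eigenspace D (\<lambda>f. - A f) c \<subseteq> span (e ` {n. lam n = c})"
    proof
      fix f assume f: "f \<in> eigenspace D (\<lambda>f. - A f) c"
      define g where "g = (\<Sum>i\<in>{n. lam n = c}. inner f (e i) *\<^sub>R e i)"
      have "inner g (e j) = (\<Sum>i\<in>{n. lam n = c}. if i = j then inner f (e i) else 0)" for j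
        unfolding g_def inner_sum_left by (intro sum.cong) (auto simp: ortho)
      then have "inner (f - g) (e j) = 0" for j
        using fin[of c] orthogonal_to_others[OF f, of j] by (auto simp: inner_diff_left)
      then have "f = g"
        using total[of "f - g"] by simp
      also have "g \<in> span (e ` {n. lam n = c})"
        unfolding g_def by (intro span_sum span_scale span_base) auto
      finally show "f \<in> span (e ` {n. lam n = c})" .
    qed
  qed
  have "eigenvalues D (\<lambda>f. - A f) = range lam"
  proof
    show "range lam \<subseteq> eigenvalues D (\<lambda>f. - A f)"
    proof clarify
      fix n
      have "e n \<noteq> 0" using ortho[of n n] by auto
      then show "lam n \<in> eigenvalues D (\<lambda>f. - A f)"
        using eigen by (auto simp: eigenvalues_def)
    qed
    show "eigenvalues D (\<lambda>f. - A f) \<subseteq> range lam"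
      using orthogonal_to_others total by (force simp: eigenvalues_def)
  qed
  moreover have "finite_dimensional (eigenspace D (\<lambda>f. - A f) c)" for c
    unfolding finite_dimensional_def space using fin by (intro exI[of _ "e ` {n. lam n = c}"]) simp
  moreover have "card {n. lam n = c} = dim (eigenspace D (\<lambda>f. - A f) c)" for c
  proof -
    have "pairwise orthogonal (e ` {n. lam n = c})"
      by (auto simp: pairwise_def orthogonal_def ortho)
    moreover have "0 \<notin> e ` {n. lam n = c}"
      using ortho by (metis imageE inner_zero_left zero_neq_one)
    ultimately have "independent (e ` {n. lam n = c})"
      by (rule pairwise_orthogonal_independent)
    then have "dim (span (e ` {n. lam n = c})) = card (e ` {n. lam n = c})"
      by (rule dim_span_eq_card_independent)
    also have "\<dots> = card {n. lam n = c}"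
      using inj_e by (intro card_image) (auto simp: inj_on_def)
    finally show ?thesis by (simp add: space)
  qed
  ultimately show thesis
    using that complete eigen lam0 lam_mono lam_lim by blast
qed

end

section \<open>The Hilbert space of the torus\<close>

lemma sets_torus [simp]: "A \<in> sets borel \<Longrightarrow> A \<subseteq> {0..<1} \<Longrightarrow> A \<in> sets torus"
  unfolding torus_def by (subst sets_restrict_space_iff) auto

lemma space_torus [simp]: "space torus = {0..<1}"
  by (simp add: torus_def space_restrict_space)

lemma borel_measurable_torus:
  "f \<in> borel_measurable borel \<Longrightarrow> f \<in> borel_measurable torus"
  unfolding torus_def by (rule measurable_restrict_space1) simp

lemma integral_torus: "integral\<^sup>L torus f = (LINT x|lborel. indicator {0..<1} x * (f x :: real))"
  unfolding torus_def by (subst integral_restrict_space) auto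

lemma measure_torus [simp]: "measure torus {0..<1} = 1"
  by (simp add: torus_def measure_restrict_space)

interpretation torus: finite_measure torus
  by (rule finite_measureI) (simp add: torus_def emeasure_restrict_space space_restrict_space)

lemma square_integrable_bounded:
  assumes "f \<in> borel_measurable torus" and "\<And>x. x \<in> {0..<1} \<Longrightarrow> \<bar>f x\<bar> \<le> B"
  shows "square_integrable f"
  unfolding square_integrable_def
proof (intro conjI assms torus.integrable_const_bound[of _ "B\<^sup>2"] AE_I2)
  fix x assume "x \<in> space torus"
  then show "norm ((f x)\<^sup>2) \<le> B\<^sup>2"
    using assms(2)[of x] power_mono[of "\<bar>f x\<bar>" B 2] by simp
qed (use assms in measurable)

lemma square_integrable_rep [simp]: "square_integrable (rep_torus_L2 f)"
  using Quotient3_rep_reflp[OF Quotient3_torus_L2, of f] by (simp add: L2_rel_def)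

lemma measurable_rep [measurable]: "rep_torus_L2 f \<in> borel_measurable torus"
  using square_integrable_rep[of f] by (simp add: square_integrable_def)

lemma integrable_rep: "integrable torus (rep_torus_L2 f)"
  using square_integrable_mult[OF square_integrable_rep[of f] square_integrable_bounded[of "\<lambda>_. 1" 1]]
  by simp

lemma rep_abs: "square_integrable F \<Longrightarrow> AE x in torus. rep_torus_L2 (abs_torus_L2 F) x = F x"
  using Quotient3_rep_abs[OF Quotient3_torus_L2, of F] by (simp add: L2_rel_def)

lemma torus_L2_eqI: "(AE x in torus. rep_torus_L2 f x = rep_torus_L2 g x) \<Longrightarrow> f = g"
  using Quotient3_rel_abs[OF Quotient3_torus_L2, of "rep_torus_L2 f" "rep_torus_L2 g"]
  by (simp add: L2_rel_def Quotient3_abs_rep[OF Quotient3_torus_L2])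

lemma abs_rep [simp]: "abs_torus_L2 (rep_torus_L2 f) = f"
  by (rule Quotient3_abs_rep[OF Quotient3_torus_L2])

lemma L2_rel_refl [simp]: "L2_rel F F \<longleftrightarrow> square_integrable F"
  by (simp add: L2_rel_def)

lemma rep_add: "AE x in torus. rep_torus_L2 (f + g) x = rep_torus_L2 f x + rep_torus_L2 g x"
  using rep_abs[OF square_integrable_add[OF square_integrable_rep square_integrable_rep, of f g]]
    plus_torus_L2.abs_eq[of "rep_torus_L2 f" "rep_torus_L2 g"] by simp

lemma rep_diff: "AE x in torus. rep_torus_L2 (f - g) x = rep_torus_L2 f x - rep_torus_L2 g x"
  using rep_abs[OF square_integrable_diff[OF square_integrable_rep square_integrable_rep, of f g]]
    minus_torus_L2.abs_eq[of "rep_torus_L2 f" "rep_torus_L2 g"] by simp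

lemma rep_scale: "AE x in torus. rep_torus_L2 (c *\<^sub>R f) x = c * rep_torus_L2 f x"
  using rep_abs[OF square_integrable_scale[OF square_integrable_rep, of c f]]
    scaleR_torus_L2.abs_eq[of "rep_torus_L2 f" c] by simp

lemma rep_zero: "AE x in torus. rep_torus_L2 0 x = 0"
  using rep_abs[OF square_integrable_zero] by (simp add: zero_torus_L2_def)

lemma inner_abs:
  "square_integrable F \<Longrightarrow> square_integrable G \<Longrightarrow>
    inner (abs_torus_L2 F) (abs_torus_L2 G) = (\<integral>x. F x * G x \<partial>torus)"
  by (rule inner_torus_L2.abs_eq) simp_all

lemma inner_rep: "inner f g = (\<integral>x. rep_torus_L2 f x * rep_torus_L2 g x \<partial>torus)"
  using inner_abs[OF square_integrable_rep square_integrable_rep, of f g] by simp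

text \<open>The distance in the form to which Fatou's lemma applies.\<close>

lemma norm_diff_nn_integral:
  assumes [simp]: "square_integrable F"
  shows "(\<integral>\<^sup>+x. ennreal ((rep_torus_L2 f x - F x)\<^sup>2) \<partial>torus) = ennreal ((norm (f - abs_torus_L2 F))\<^sup>2)"
proof -
  have sq: "square_integrable (\<lambda>x. rep_torus_L2 f x - F x)"
    by (rule square_integrable_diff) simp_all
  have "f - abs_torus_L2 F = abs_torus_L2 (\<lambda>x. rep_torus_L2 f x - F x)"
    using minus_torus_L2.abs_eq[of "rep_torus_L2 f" F] by simp
  then have norm_eq: "(norm (f - abs_torus_L2 F))\<^sup>2 = (\<integral>x. (rep_torus_L2 f x - F x)\<^sup>2 \<partial>torus)"
    using inner_abs[OF sq sq] unfolding power2_norm_eq_inner by (simp add: power2_eq_square)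
  have "integrable torus (\<lambda>x. (rep_torus_L2 f x - F x)\<^sup>2)"
    using sq by (simp only: square_integrable_def)
  then show ?thesis
    unfolding norm_eq by (rule nn_integral_eq_integral) simp
qed

text \<open>Cauchy-Schwarz against the constant \<open>1\<close>, whose norm is \<open>1\<close>.\<close>

lemma L1_le_norm: "(\<integral>x. \<bar>rep_torus_L2 f x\<bar> \<partial>torus) \<le> norm f"
proof -
  have sq_one: "square_integrable (\<lambda>_. 1)"
    by (rule square_integrable_bounded[of _ 1]) auto
  have sq: "square_integrable (\<lambda>x. \<bar>rep_torus_L2 f x\<bar>)"
    using square_integrable_rep[of f] by (auto simp: square_integrable_def)
  have "(\<integral>x. \<bar>rep_torus_L2 f x\<bar> \<partial>torus) = inner (abs_torus_L2 (\<lambda>x. \<bar>rep_torus_L2 f x\<bar>)) (abs_torus_L2 (\<lambda>_. 1))"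
    by (simp add: inner_abs[OF sq sq_one])
  also have "\<dots> \<le> norm (abs_torus_L2 (\<lambda>x. \<bar>rep_torus_L2 f x\<bar>)) * norm (abs_torus_L2 (\<lambda>_. 1))"
    by (rule norm_cauchy_schwarz)
  also have "\<dots> = norm f"
    by (simp add: norm_eq_sqrt_inner inner_abs[OF sq sq] inner_abs[OF sq_one sq_one] inner_rep[of f f])
  finally show ?thesis .
qed

text \<open>Riesz-Fischer: a Cauchy sequence is Cauchy in \<open>L\<^sup>1\<close>, so a subsequence converges almost
  everywhere, and Fatou's lemma turns the pointwise limit into a limit in the norm.\<close>

instance torus_L2 :: complete_space
proof
  fix X :: "nat \<Rightarrow> torus_L2" assume "Cauchy X"
  define F where "F n = rep_torus_L2 (X n)" for n
  have [measurable]: "F n \<in> borel_measurable torus" for n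
    unfolding F_def by measurable
  have F_int: "integrable torus (F n)" for n
    unfolding F_def by (rule integrable_rep)
  have F_cauchy: "\<exists>N. \<forall>i\<ge>N. \<forall>j\<ge>N. (\<integral>x. norm (F i x - F j x) \<partial>torus) < \<epsilon>" if "0 < \<epsilon>" for \<epsilon>
  proof -
    have "(\<integral>x. norm (F i x - F j x) \<partial>torus) \<le> dist (X i) (X j)" for i j
    proof -
      have "(\<integral>x. norm (F i x - F j x) \<partial>torus) = (\<integral>x. \<bar>rep_torus_L2 (X i - X j) x\<bar> \<partial>torus)"
        using rep_diff[of "X i" "X j"] by (intro integral_cong_AE) (auto simp: F_def)
      then show ?thesis
        using L1_le_norm[of "X i - X j"] by (simp add: dist_norm)
    qed
    then show ?thesis
      using \<open>Cauchy X\<close> that unfolding Cauchy_def by (meson le_less_trans)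
  qed
  obtain r where r: "strict_mono r" "AE x in torus. Cauchy (\<lambda>i. F (r i) x)"
    using cauchy_L1_AE_cauchy_subseq[OF F_int F_cauchy] by blast
  define G where "G x = lim (\<lambda>i. F (r i) x)" for x
  have G_meas [measurable]: "G \<in> borel_measurable torus"
    unfolding G_def by measurable
  have G: "AE x in torus. (\<lambda>i. F (r i) x) \<longlonglongrightarrow> G x"
    using r(2) by eventually_elim (simp add: G_def Cauchy_convergent_iff convergent_LIMSEQ_iff)
  have fatou: "(\<integral>\<^sup>+x. ennreal ((F m x - G x)\<^sup>2) \<partial>torus) \<le> ennreal (\<epsilon>\<^sup>2)"
    if N: "\<And>m n. m \<ge> N \<Longrightarrow> n \<ge> N \<Longrightarrow> dist (X m) (X n) < \<epsilon>" and "N \<le> m" for \<epsilon> N m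
  proof -
    have "(\<integral>\<^sup>+x. ennreal ((F m x - G x)\<^sup>2) \<partial>torus)
        = (\<integral>\<^sup>+x. liminf (\<lambda>i. ennreal ((F m x - F (r i) x)\<^sup>2)) \<partial>torus)"
      using G
    proof (intro nn_integral_cong_AE, eventually_elim)
      fix x assume "(\<lambda>i. F (r i) x) \<longlonglongrightarrow> G x"
      then have "(\<lambda>i. ennreal ((F m x - F (r i) x)\<^sup>2)) \<longlonglongrightarrow> ennreal ((F m x - G x)\<^sup>2)"
        by (intro tendsto_intros)
      then show "ennreal ((F m x - G x)\<^sup>2) = liminf (\<lambda>i. ennreal ((F m x - F (r i) x)\<^sup>2))"
        by (rule lim_imp_Liminf[symmetric, rotated]) simp
    qed
    also have "\<dots> \<le> liminf (\<lambda>i. \<integral>\<^sup>+x. ennreal ((F m x - F (r i) x)\<^sup>2) \<partial>torus)"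
      by (rule nn_integral_liminf) measurable
    also have "\<dots> \<le> ennreal (\<epsilon>\<^sup>2)"
    proof (rule Liminf_le)
      have "(\<integral>\<^sup>+x. ennreal ((F m x - F (r i) x)\<^sup>2) \<partial>torus) \<le> ennreal (\<epsilon>\<^sup>2)" if "N \<le> i" for i
      proof -
        have "dist (X m) (X (r i)) < \<epsilon>"
          using seq_suble[OF r(1), of i] that by (intro N \<open>N \<le> m\<close>) simp
        then show ?thesis
          using norm_diff_nn_integral[of "rep_torus_L2 (X (r i))" "X m"]
          by (auto simp: F_def dist_norm intro!: ennreal_leI power_mono)
      qed
      then show "\<forall>\<^sub>F i in sequentially. (\<integral>\<^sup>+x. ennreal ((F m x - F (r i) x)\<^sup>2) \<partial>torus) \<le> ennreal (\<epsilon>\<^sup>2)"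
        by (auto simp: eventually_sequentially)
    qed simp
    finally show ?thesis .
  qed
  have cauchy: "\<exists>N. \<forall>m\<ge>N. \<forall>n\<ge>N. dist (X m) (X n) < \<epsilon>" if "0 < \<epsilon>" for \<epsilon>
    using \<open>Cauchy X\<close> that unfolding Cauchy_def by blast
  have sq: "square_integrable G"
  proof -
    obtain N where N: "\<And>m n. m \<ge> N \<Longrightarrow> n \<ge> N \<Longrightarrow> dist (X m) (X n) < 1"
      using cauchy[of 1] by auto
    have "(\<integral>\<^sup>+x. ennreal ((F N x - G x)\<^sup>2) \<partial>torus) \<le> ennreal (1\<^sup>2)"
      by (rule fatou[of N]) (auto intro: N)
    also have "\<dots> < \<infinity>" by simp
    finally have "integrable torus (\<lambda>x. (F N x - G x)\<^sup>2)"
      by (intro integrableI_bounded) simp_all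
    then have "square_integrable (\<lambda>x. F N x - G x)"
      by (simp add: square_integrable_def)
    then have "square_integrable (\<lambda>x. F N x - (F N x - G x))"
      by (rule square_integrable_diff[rotated]) (simp add: F_def)
    then show ?thesis by simp
  qed
  have "X \<longlonglongrightarrow> abs_torus_L2 G"
  proof (rule metric_LIMSEQ_I)
    fix \<epsilon> :: real assume "0 < \<epsilon>"
    then obtain N where N: "\<And>m n. m \<ge> N \<Longrightarrow> n \<ge> N \<Longrightarrow> dist (X m) (X n) < \<epsilon> / 2"
      using cauchy[of "\<epsilon> / 2"] by auto
    have "dist (X m) (abs_torus_L2 G) < \<epsilon>" if "N \<le> m" for m
    proof -
      have "ennreal ((norm (X m - abs_torus_L2 G))\<^sup>2) \<le> ennreal ((\<epsilon> / 2)\<^sup>2)"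
        using fatou[OF N that] norm_diff_nn_integral[OF sq, of "X m"] by (simp add: F_def)
      then have "(norm (X m - abs_torus_L2 G))\<^sup>2 \<le> (\<epsilon> / 2)\<^sup>2"
        by (subst (asm) ennreal_le_iff) simp_all
      then have "norm (X m - abs_torus_L2 G) \<le> \<epsilon> / 2"
        by (rule power2_le_imp_le) (use \<open>0 < \<epsilon>\<close> in simp)
      then show ?thesis
        using \<open>0 < \<epsilon>\<close> by (simp add: dist_norm)
    qed
    then show "\<exists>N. \<forall>m\<ge>N. dist (X m) (abs_torus_L2 G) < \<epsilon>" by blast
  qed
  then show "convergent X" by (rule convergentI)
qed

definition indicator_class :: "real \<Rightarrow> real \<Rightarrow> torus_L2" where
  "indicator_class a b = abs_torus_L2 (indicator {a..<b})"

lemma square_integrable_indicator: "square_integrable (indicator {a..<b::real})"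
  by (rule square_integrable_bounded[of _ 1]) (auto simp: indicator_def intro!: borel_measurable_torus)

lemma inner_indicator_class:
  assumes "0 \<le> a" "b \<le> 1"
  shows "inner f (indicator_class a b) = (LINT x:{a..<b}|lborel. rep_torus_L2 f x)"
proof -
  have "inner f (indicator_class a b) = inner (abs_torus_L2 (rep_torus_L2 f)) (indicator_class a b)" by simp
  also have "\<dots> = (\<integral>x. rep_torus_L2 f x * indicator {a..<b} x \<partial>torus)"
    unfolding indicator_class_def by (intro inner_abs square_integrable_indicator square_integrable_rep)
  also have "\<dots> = (LINT x:{a..<b}|lborel. rep_torus_L2 f x)"
    unfolding integral_torus set_lebesgue_integral_def
    using assms by (intro Bochner_Integration.integral_cong) (auto simp: indicator_def)
  finally show ?thesis .
qed

lemma inner_indicator_class_indicator_class: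
  assumes "0 \<le> a" "b \<le> 1" "0 \<le> c" "d \<le> 1"
  shows "inner (indicator_class a b) (indicator_class c d) = max 0 (min b d - max a c)"
proof -
  have "inner (indicator_class a b) (indicator_class c d) = (\<integral>x. indicator {a..<b} x * indicator {c..<d} x \<partial>torus)"
    unfolding indicator_class_def by (intro inner_abs square_integrable_indicator)
  also have "\<dots> = (LINT x|lborel. indicator {max a c..<min b d} x)"
    unfolding integral_torus
    using assms by (intro Bochner_Integration.integral_cong) (auto simp: indicator_def)
  also have "\<dots> = max 0 (min b d - max a c)"
    by (cases "max a c \<le> min b d") auto
  finally show ?thesis .
qed

text \<open>The indicators of the disjoint intervals \<open>[1/(k+2), 1/(k+1))\<close> form an infinite orthogonal
  family.\<close>

lemma torus_L2_infinite_dimensional: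
  assumes "finite (B :: torus_L2 set)"
  shows "span B \<noteq> UNIV"
proof
  assume span: "span B = UNIV"
  define u where "u k = indicator_class (1 / (real k + 2)) (1 / (real k + 1))" for k :: nat
  have self: "inner (u k) (u k) > 0" for k
  proof -
    have "1 / (real k + 2) < 1 / (real k + 1)"
      by (intro divide_strict_left_mono) auto
    then show ?thesis
      unfolding u_def by (subst inner_indicator_class_indicator_class) auto
  qed
  have other: "inner (u j) (u k) = 0" if "j < k" for j k
  proof -
    have "1 / (real k + 1) \<le> 1 / (real j + 2)"
      using that by (intro divide_left_mono) auto
    then show ?thesis
      unfolding u_def by (subst inner_indicator_class_indicator_class) auto
  qed
  have ortho: "inner (u j) (u k) = 0" if "j \<noteq> k" for j k
    using that other by (metis inner_commute nat_neq_iff)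
  have "inj u"
    using self ortho by (metis injI less_irrefl)
  then have "infinite (range u)"
    by (simp add: finite_image_iff)
  have "pairwise orthogonal (range u)"
    unfolding pairwise_def orthogonal_def using ortho by (metis imageE)
  moreover have "0 \<notin> range u"
    using self by (metis imageE inner_zero_left less_irrefl)
  ultimately have "independent (range u)"
    by (rule pairwise_orthogonal_independent)
  then have "finite (range u)"
    using independent_span_bound[OF assms, of "range u"] span by auto
  with \<open>infinite (range u)\<close> show False by blast
qed

section \<open>Primitives of square integrable functions\<close>

text \<open>As a scalar product, the primitive is visibly linear in \<open>g\<close>, and its increments are
  bounded by the Cauchy-Schwarz inequality.\<close>

lemma primitive_eq_inner: "y \<le> 1 \<Longrightarrow> primitive g y = inner g (indicator_class 0 y)"
  by (simp add: primitive_def inner_indicator_class)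

lemma primitive_diff_eq_inner:
  assumes "0 \<le> x" "x \<le> y" "y \<le> 1"
  shows "primitive g y - primitive g x = inner g (indicator_class x y)"
proof -
  have "indicator_class 0 y - indicator_class 0 x = indicator_class x y"
  proof (rule torus_L2_eqI)
    have "AE z in torus. rep_torus_L2 (indicator_class a b) z = indicator {a..<b} z" for a b
      unfolding indicator_class_def by (rule rep_abs[OF square_integrable_indicator])
    from this[of 0 y] this[of 0 x] this[of x y] rep_diff[of "indicator_class 0 y" "indicator_class 0 x"]
    show "AE z in torus. rep_torus_L2 (indicator_class 0 y - indicator_class 0 x) z = rep_torus_L2 (indicator_class x y) z"
      by eventually_elim (use assms in \<open>auto simp: indicator_def\<close>)
  qed
  then show ?thesis
    using assms by (simp add: primitive_eq_inner flip: inner_diff_right)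
qed

lemma norm_indicator_class: "0 \<le> a \<Longrightarrow> a \<le> b \<Longrightarrow> b \<le> 1 \<Longrightarrow> norm (indicator_class a b) = sqrt (b - a)"
  by (simp add: norm_eq_sqrt_inner inner_indicator_class_indicator_class)

lemma primitive_hoelder:
  assumes "0 \<le> x" "x \<le> y" "y \<le> 1"
  shows "\<bar>primitive g y - primitive g x\<bar> \<le> norm g * sqrt (y - x)"
  using Cauchy_Schwarz_ineq2[of g "indicator_class x y"] assms by (simp add: primitive_diff_eq_inner norm_indicator_class)

lemma primitive_hoelder_abs:
  assumes "x \<in> {0..1}" "y \<in> {0..1}"
  shows "\<bar>primitive g y - primitive g x\<bar> \<le> norm g * sqrt \<bar>y - x\<bar>"
  using primitive_hoelder[of x y g] primitive_hoelder[of y x g] assms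
  by (cases "x \<le> y") (auto simp: abs_minus_commute)

lemma primitive_0 [simp]: "primitive g 0 = 0"
  by (simp add: primitive_def set_lebesgue_integral_def)

lemma primitive_bound: "y \<in> {0..1} \<Longrightarrow> \<bar>primitive g y\<bar> \<le> norm g"
proof -
  assume y: "y \<in> {0..1}"
  then have "\<bar>primitive g y\<bar> \<le> norm g * sqrt y"
    using primitive_hoelder[of 0 y g] by simp
  also have "\<dots> \<le> norm g * 1"
    using y by (intro mult_left_mono) auto
  finally show ?thesis by simp
qed

lemma continuous_on_primitive: "continuous_on {0..1} (primitive g)"
proof -
  have "((\<lambda>x. primitive g x) \<longlongrightarrow> primitive g y) (at y within {0..1})" if y: "y \<in> {0..1}" for y
  proof -
    have "((\<lambda>x. norm g * sqrt \<bar>x - y\<bar>) \<longlongrightarrow> norm g * sqrt \<bar>y - y\<bar>) (at y within {0..1})"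
      by (intro tendsto_intros)
    then have "((\<lambda>x. norm g * sqrt \<bar>x - y\<bar>) \<longlongrightarrow> 0) (at y within {0..1})"
      by simp
    then have "((\<lambda>x. primitive g x - primitive g y) \<longlongrightarrow> 0) (at y within {0..1})"
    proof (rule Lim_null_comparison[rotated])
      show "\<forall>\<^sub>F x in at y within {0..1}. norm (primitive g x - primitive g y) \<le> norm g * sqrt \<bar>x - y\<bar>"
        using primitive_hoelder_abs[OF y] by (auto simp: eventually_at_filter)
    qed
    then show ?thesis by (rule LIM_zero_cancel)
  qed
  then show ?thesis by (simp add: continuous_on_def)
qed

lemma primitive_add: "y \<le> 1 \<Longrightarrow> primitive (f + g) y = primitive f y + primitive g y"
  by (simp add: primitive_eq_inner inner_add_left)

lemma primitive_scale: "y \<le> 1 \<Longrightarrow> primitive (c *\<^sub>R g) y = c * primitive g y"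
  by (simp add: primitive_eq_inner)

text \<open>The intervals \<open>{..<y}\<close> form a generator of the Borel sets that is closed under intersection,
  so the integral of \<open>g\<close> vanishes over every Borel set, and \<open>g\<close> vanishes almost everywhere.\<close>

lemma primitive_eq_0_imp:
  assumes "\<And>y. y \<in> {0..1} \<Longrightarrow> primitive g y = 0"
  shows "g = 0"
proof -
  let ?F = "rep_torus_L2 g"
  \<comment> \<open>Intersecting with the torus turns \<open>\<nu>\<close> into a function of arbitrary Borel sets of reals.\<close>
  define \<nu> where "\<nu> A = (LINT x:A \<inter> {0..<1}|torus. ?F x)" for A
  have int: "set_integrable torus A ?F" if "A \<in> sets torus" for A
    using integrable_mult_indicator[OF that integrable_rep] by (simp add: set_integrable_def)
  have lim: "\<nu> {..<y} = 0" for y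
  proof -
    define z where "z = max 0 (min y 1)"
    have "\<nu> {..<y} = (LINT x:{0..<z}|lborel. ?F x)"
      unfolding \<nu>_def set_lebesgue_integral_def integral_torus
      by (intro Bochner_Integration.integral_cong) (auto simp: indicator_def z_def)
    also have "\<dots> = 0"
      using assms[of z] by (simp add: primitive_def z_def)
    finally show ?thesis .
  qed
  have total: "\<nu> UNIV = 0"
  proof -
    have "\<nu> UNIV = \<nu> {..<1}"
      unfolding \<nu>_def by (intro arg_cong[where f = "\<lambda>A. set_lebesgue_integral torus A ?F"]) auto
    then show ?thesis by (simp add: lim)
  qed
  have all: "\<nu> A = 0" if "A \<in> sets borel" for A
  proof -
    have gen: "sets (borel :: real measure) = sigma_sets UNIV (range lessThan)"
      by (subst borel_Iio) simp
    have "{..<a} \<inter> {..<b} = {..<min a b}" for a b :: real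
      by auto
    then have "Int_stable (range (lessThan :: real \<Rightarrow> real set))"
      by (auto simp: Int_stable_def)
    moreover have "range (lessThan :: real \<Rightarrow> real set) \<subseteq> Pow UNIV"
      by simp
    moreover have "A \<in> sigma_sets UNIV (range lessThan)"
      using that unfolding gen .
    ultimately show ?thesis
    proof (induction rule: sigma_sets_induct_disjoint)
      case (basic A)
      then show ?case using lim by auto
    next
      case empty
      then show ?case by (simp add: \<nu>_def set_lebesgue_integral_def)
    next
      case (compl A)
      then have [measurable]: "A \<in> sets borel" by (simp add: gen)
      have "\<nu> UNIV = \<nu> A + \<nu> (UNIV - A)"
        unfolding \<nu>_def
        by (subst set_integral_Un[symmetric])
          (auto intro!: int arg_cong[where f = "\<lambda>A. set_lebesgue_integral torus A ?F"])
      then show ?case using compl total by simp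
    next
      case (union A)
      then have [measurable]: "A i \<in> sets borel" for i by (auto simp: gen)
      have "\<nu> (\<Union>i. A i) = (LINT x:(\<Union>i. A i \<inter> {0..<1})|torus. ?F x)"
        by (simp add: \<nu>_def)
      also have "\<dots> = (\<Sum>i. \<nu> (A i))"
        unfolding \<nu>_def using union(1)
        by (intro lebesgue_integral_countable_add int) (auto simp: disjoint_family_on_def)
      finally show ?case using union by simp
    qed
  qed
  have "AE x in torus. ?F x = 0"
  proof (rule torus.density_zero[OF integrable_rep])
    fix A assume A: "A \<in> sets torus"
    then have "A \<in> sets borel" "A \<subseteq> {0..<1}"
      unfolding torus_def by (auto simp: sets_restrict_space)
    then show "set_lebesgue_integral torus A ?F = 0"
      using all[of A] by (simp add: \<nu>_def Int_absorb2)
  qed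
  with rep_zero have "AE x in torus. ?F x = rep_torus_L2 0 x"
    by eventually_elim simp
  then show ?thesis by (rule torus_L2_eqI)
qed

definition torus_one :: torus_L2 where
  "torus_one = indicator_class 0 1"

lemma norm_torus_one [simp]: "norm torus_one = 1"
  by (simp add: torus_one_def norm_indicator_class)

lemma inner_torus_one [simp]: "inner torus_one torus_one = 1"
  by (simp add: torus_one_def inner_indicator_class_indicator_class)

lemma rep_torus_one: "AE x in torus. rep_torus_L2 torus_one x = 1"
  using rep_abs[OF square_integrable_indicator[of 0 1]] AE_space
  by eventually_elim (simp add: torus_one_def indicator_class_def)

lemma primitive_1: "primitive g 1 = inner g torus_one"
  by (simp add: primitive_eq_inner torus_one_def)

text \<open>The torus has total mass \<open>1\<close>.\<close>

lemma norm_le_AE_bound: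
  assumes "0 \<le> B" "AE x in torus. \<bar>rep_torus_L2 f x\<bar> \<le> B"
  shows "norm f \<le> B"
proof (rule power2_le_imp_le)
  have "(norm f)\<^sup>2 = (\<integral>x. (rep_torus_L2 f x)\<^sup>2 \<partial>torus)"
    unfolding power2_norm_eq_inner inner_rep by (simp add: power2_eq_square)
  also have "\<dots> \<le> (\<integral>x. B\<^sup>2 \<partial>torus)"
  proof (rule integral_mono_AE)
    show "AE x in torus. (rep_torus_L2 f x)\<^sup>2 \<le> B\<^sup>2"
      using assms(2) by eventually_elim (use assms(1) in \<open>simp add: abs_le_square_iff[symmetric]\<close>)
    show "integrable torus (\<lambda>x. (rep_torus_L2 f x)\<^sup>2)"
      using square_integrable_rep[of f] by (simp only: square_integrable_def)
  qed simp
  also have "\<dots> = B\<^sup>2" by simp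
  finally show "(norm f)\<^sup>2 \<le> B\<^sup>2" .
qed fact

text \<open>Arzela-Ascoli: the primitives are bounded by \<open>B\<close> and Hoelder continuous of exponent \<open>1/2\<close>
  with constant \<open>B\<close>.\<close>

lemma primitive_uniformly_convergent_subseq:
  assumes B: "\<And>n. norm (g n) \<le> B"
  obtains k :: "nat \<Rightarrow> nat" and G where "strict_mono k"
    "\<And>e. 0 < e \<Longrightarrow> \<exists>N. \<forall>n\<ge>N. \<forall>y\<in>{0..1}. \<bar>primitive (g (k n)) y - G y\<bar> < e"
proof -
  have "0 \<le> B" using B[of 0] norm_ge_zero order_trans by blast
  have bound: "norm (primitive (g n) y) \<le> B" if "y \<in> {0..1}" for n y
    using primitive_bound[OF that, of "g n"] B[of n] by simp
  have equicontinuous: "\<exists>d. 0 < d \<and> (\<forall>n y. y \<in> {0..1} \<and> norm (x - y) < d \<longrightarrow>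
      norm (primitive (g n) x - primitive (g n) y) < e)" if x: "x \<in> {0..1}" and "0 < e" for x e :: real
  proof -
    \<comment> \<open>\<open>B + 1\<close> instead of \<open>B\<close> avoids division by zero.\<close>
    define d where "d = (e / (B + 1))\<^sup>2"
    have "0 < d" using \<open>0 < e\<close> \<open>0 \<le> B\<close> by (simp add: d_def)
    have "norm (primitive (g n) x - primitive (g n) y) < e" if y: "y \<in> {0..1}" "norm (x - y) < d" for n y
    proof -
      have "sqrt \<bar>x - y\<bar> < sqrt d" using y by simp
      also have "sqrt d = e / (B + 1)"
        using \<open>0 < e\<close> \<open>0 \<le> B\<close> by (simp add: d_def)
      finally have less: "sqrt \<bar>x - y\<bar> < e / (B + 1)" .
      have "norm (primitive (g n) x - primitive (g n) y) \<le> norm (g n) * sqrt \<bar>x - y\<bar>"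
        using primitive_hoelder_abs[OF y(1) x, of "g n"] by simp
      also have "\<dots> \<le> (B + 1) * sqrt \<bar>x - y\<bar>"
        using B[of n] by (intro mult_right_mono) auto
      also have "\<dots> < (B + 1) * (e / (B + 1))"
        using less \<open>0 \<le> B\<close> by (intro mult_strict_left_mono) auto
      also have "\<dots> = e" using \<open>0 \<le> B\<close> by simp
      finally show ?thesis .
    qed
    then show ?thesis
      using \<open>0 < d\<close> by blast
  qed
  show thesis
  proof (rule Arzela_Ascoli[OF compact_Icc bound equicontinuous])
    fix G and k :: "nat \<Rightarrow> nat"
    assume k: "strict_mono k"
      and G: "\<And>e. 0 < e \<Longrightarrow> \<exists>N. \<forall>n y. n \<ge> N \<and> y \<in> {0..1} \<longrightarrow> norm (primitive (g (k n)) y - G y) < e"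
    have "\<exists>N. \<forall>n\<ge>N. \<forall>y\<in>{0..1}. \<bar>primitive (g (k n)) y - G y\<bar> < e" if "0 < e" for e
      using G[OF that] unfolding real_norm_def by blast
    with k show thesis by (rule that)
  qed
qed

section \<open>Integration against the Stieltjes measure\<close>

text \<open>For such \<open>W\<close> the Stieltjes measure gives every nonempty interval \<open>{p<..q}\<close> positive mass.\<close>

locale stieltjes_weight =
  fixes W :: "real \<Rightarrow> real"
  assumes W_strict_mono: "strict_mono W"
    and W_right_continuous: "\<And>u. continuous (at_right u) W"
    and W_0: "W 0 = 0"
begin

definition \<nu> :: "real measure" where
  "\<nu> = restrict_space (interval_measure W) {0<..1}"

text \<open>For \<open>0 \<le> x \<le> 1\<close> this is the integral of \<open>v\<close> over \<open>{0<..x}\<close>; cutting off the integrand rather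
  than the domain suits Fubini's theorem.\<close>

definition W_integral :: "(real \<Rightarrow> real) \<Rightarrow> real \<Rightarrow> real" where
  "W_integral v x = (\<integral>y. (if y \<le> x then v y else 0) \<partial>\<nu>)"

lemma W_mono: "x \<le> y \<Longrightarrow> W x \<le> W y"
  using W_strict_mono by (simp add: strict_mono_less_eq)

lemma space_\<nu> [simp]: "space \<nu> = {0<..1}"
  by (simp add: \<nu>_def space_restrict_space)

lemma sets_\<nu> [measurable_cong]: "sets \<nu> = sets (restrict_space borel {0<..1})"
  unfolding \<nu>_def by (rule sets_restrict_space_cong) simp

lemma emeasure_\<nu>: "0 \<le> p \<Longrightarrow> p \<le> q \<Longrightarrow> q \<le> 1 \<Longrightarrow> emeasure \<nu> {p<..q} = W q - W p"
  unfolding \<nu>_def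
  by (subst emeasure_restrict_space)
    (auto simp: emeasure_interval_measure_Ioc W_mono W_right_continuous)

lemma measure_\<nu>: "0 \<le> p \<Longrightarrow> p \<le> q \<Longrightarrow> q \<le> 1 \<Longrightarrow> measure \<nu> {p<..q} = W q - W p"
  by (simp add: measure_def emeasure_\<nu> W_mono)

lemma Ioc_in_sets_\<nu> [simp]: "0 \<le> p \<Longrightarrow> q \<le> 1 \<Longrightarrow> {p<..q} \<in> sets \<nu>"
  unfolding sets_\<nu> by (subst sets_restrict_space_iff) auto

sublocale \<nu>: finite_measure \<nu>
  by (rule finite_measureI) (simp add: emeasure_\<nu>)

lemma total_mass [simp]: "measure \<nu> {0<..1} = W 1"
  by (simp add: measure_\<nu> W_0)

lemma W_1_pos: "0 < W 1"
  using strict_monoD[OF W_strict_mono, of 0 1] by (simp add: W_0)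

lemma measurable_\<nu>:
  fixes v :: "real \<Rightarrow> real"
  assumes "continuous_on {0..1} v"
  shows "v \<in> borel_measurable \<nu>"
proof -
  have "v \<in> borel_measurable (restrict_space borel {0<..1})"
    using assms by (intro borel_measurable_continuous_on_restrict continuous_on_subset[OF assms]) auto
  then show ?thesis
    by (simp add: measurable_cong_sets[OF sets_\<nu> refl])
qed

lemma continuous_bounded:
  assumes "continuous_on {0..1::real} v"
  obtains C :: real where "\<And>y. y \<in> {0..1} \<Longrightarrow> \<bar>v y\<bar> \<le> C"
proof -
  have "bounded (v ` {0..1})"
    by (rule compact_imp_bounded[OF compact_continuous_image[OF assms]]) simp
  then obtain C where "\<forall>y\<in>{0..1}. \<bar>v y\<bar> \<le> C"
    by (auto simp: bounded_iff)
  then show thesis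
    by (intro that) blast
qed

lemma integrable_\<nu>:
  fixes v :: "real \<Rightarrow> real"
  assumes "continuous_on {0..1} v"
  shows "integrable \<nu> v"
proof -
  obtain C where "\<And>y. y \<in> {0..1} \<Longrightarrow> \<bar>v y\<bar> \<le> C"
    using continuous_bounded[OF assms] by blast
  then show ?thesis
    by (intro \<nu>.integrable_const_bound[of _ C] measurable_\<nu>[OF assms] AE_I2) auto
qed

lemma integrable_cut:
  fixes v :: "real \<Rightarrow> real"
  assumes "continuous_on {0..1} v"
  shows "integrable \<nu> (\<lambda>y. if y \<le> x then v y else 0)"
proof -
  have [measurable]: "v \<in> borel_measurable \<nu>" by (rule measurable_\<nu>[OF assms])
  have "{..x} \<inter> space \<nu> \<in> sets \<nu>"
    unfolding sets_\<nu> by (subst sets_restrict_space_iff) auto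
  then have "integrable \<nu> (\<lambda>y. indicator ({..x} \<inter> space \<nu>) y *\<^sub>R v y)"
    using integrable_\<nu>[OF assms] by (rule integrable_mult_indicator)
  then show ?thesis
    by (rule Bochner_Integration.integrable_cong[THEN iffD1, rotated 2]) (auto simp: indicator_def)
qed

lemma W_integral_add:
  assumes "continuous_on {0..1} v" "continuous_on {0..1} w"
  shows "W_integral (\<lambda>y. v y + w y) x = W_integral v x + W_integral w x"
  unfolding W_integral_def
  by (subst Bochner_Integration.integral_add[OF integrable_cut[OF assms(1)] integrable_cut[OF assms(2)], symmetric])
    (auto intro!: Bochner_Integration.integral_cong)

lemma W_integral_scale: "W_integral (\<lambda>y. c * v y) x = c * W_integral v x"
  unfolding W_integral_def
  by (subst Bochner_Integration.integral_mult_right_zero[symmetric])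
    (rule Bochner_Integration.integral_cong, auto)

lemma W_integral_const:
  assumes "x \<in> {0..1}"
  shows "W_integral (\<lambda>y. b) x = b * W x"
proof -
  have "W_integral (\<lambda>y. b) x = (\<integral>y. b * indicator {0<..x} y \<partial>\<nu>)"
    unfolding W_integral_def by (intro Bochner_Integration.integral_cong) (auto simp: indicator_def)
  also have "\<dots> = b * measure \<nu> {0<..x}"
    using assms by (simp add: Int_absorb2)
  also have "\<dots> = b * W x"
    using assms by (simp add: measure_\<nu> W_0)
  finally show ?thesis .
qed

lemma W_integral_1: "W_integral v 1 = (\<integral>y. v y \<partial>\<nu>)"
  unfolding W_integral_def by (intro Bochner_Integration.integral_cong) auto

lemma W_integral_bound:
  assumes "continuous_on {0..1} v" "\<And>y. y \<in> {0..1} \<Longrightarrow> \<bar>v y\<bar> \<le> C"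
  shows "\<bar>W_integral v x\<bar> \<le> C * W 1"
proof -
  have "0 \<le> C" using assms(2)[of 0] by simp
  have "\<bar>W_integral v x\<bar> \<le> (\<integral>y. \<bar>if y \<le> x then v y else 0\<bar> \<partial>\<nu>)"
    unfolding W_integral_def by (rule integral_abs_bound)
  also have "\<dots> \<le> (\<integral>y. C \<partial>\<nu>)"
    using assms \<open>0 \<le> C\<close>
    by (intro integral_mono) (auto intro: integrable_cut integrable_abs)
  finally show ?thesis by (simp add: mult.commute)
qed

lemma set_integral_eq_W_integral:
  assumes "x \<in> {0..1}"
  shows "(LINT y:{0<..x}|interval_measure W. v y) = W_integral v x"
proof -
  have "W_integral v x = (\<integral>y. indicator {0<..1} y *\<^sub>R (if y \<le> x then v y else 0) \<partial>interval_measure W)"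
    unfolding W_integral_def \<nu>_def by (rule integral_restrict_space) simp
  also have "\<dots> = (LINT y:{0<..x}|interval_measure W. v y)"
    unfolding set_lebesgue_integral_def
    using assms by (intro Bochner_Integration.integral_cong) (auto simp: indicator_def)
  finally show ?thesis ..
qed

lemma measurable_pair_cut:
  fixes v :: "real \<Rightarrow> real"
  assumes v: "continuous_on {0..1} v"
  shows "(\<lambda>(x, y). if y \<le> x then v y else 0) \<in> borel_measurable (torus \<Otimes>\<^sub>M \<nu>)"
proof -
  have [measurable]: "v \<in> borel_measurable \<nu>" by (rule measurable_\<nu>[OF v])
  have [measurable]: "(\<lambda>x. x) \<in> borel_measurable torus"
    by (rule borel_measurable_torus) simp
  have [measurable]: "(\<lambda>x. x) \<in> borel_measurable \<nu>"
    by (rule measurable_\<nu>) (rule continuous_on_id)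
  show ?thesis by measurable
qed

lemma measurable_W_integral:
  assumes "continuous_on {0..1} v"
  shows "W_integral v \<in> borel_measurable torus"
  unfolding W_integral_def[abs_def]
  using \<nu>.borel_measurable_lebesgue_integral[OF measurable_pair_cut[OF assms]] by simp

lemma square_integrable_W_integral:
  assumes "continuous_on {0..1} v"
  shows "square_integrable (W_integral v)"
proof -
  obtain C where "\<And>y. y \<in> {0..1} \<Longrightarrow> \<bar>v y\<bar> \<le> C"
    using continuous_bounded[OF assms] by blast
  then show ?thesis
    by (intro square_integrable_bounded[of _ "C * W 1"] measurable_W_integral assms W_integral_bound)
qed

text \<open>Integration by parts, by exchanging the integrals over the triangle \<open>y \<le> x\<close>: for fixed \<open>y\<close>
  the inner integral of \<open>g\<close> runs over \<open>{y..<1}\<close>.\<close>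

lemma integral_mult_W_integral:
  assumes v: "continuous_on {0..1} v"
  shows "(\<integral>x. rep_torus_L2 g x * W_integral v x \<partial>torus) = (\<integral>y. v y * (primitive g 1 - primitive g y) \<partial>\<nu>)"
proof -
  interpret pair_sigma_finite torus \<nu> ..
  define k where "k x y = rep_torus_L2 g x * (if y \<le> x then v y else 0)" for x y
  have [measurable]: "(\<lambda>(x, y). if y \<le> x then v y else 0) \<in> borel_measurable (torus \<Otimes>\<^sub>M \<nu>)"
    by (rule measurable_pair_cut[OF v])
  have k_meas: "(\<lambda>(x, y). k x y) \<in> borel_measurable (torus \<Otimes>\<^sub>M \<nu>)"
  proof -
    have "(\<lambda>p. rep_torus_L2 g (fst p) * (case p of (x, y) \<Rightarrow> if y \<le> x then v y else 0))
        \<in> borel_measurable (torus \<Otimes>\<^sub>M \<nu>)"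
      by measurable
    then show ?thesis by (simp add: k_def case_prod_beta')
  qed
  obtain C where C: "\<And>y. y \<in> {0..1} \<Longrightarrow> \<bar>v y\<bar> \<le> C"
    using continuous_bounded[OF v] by blast
  have row: "integrable \<nu> (k x)" for x
    unfolding k_def by (intro integrable_mult_right integrable_cut v)
  have "integrable torus (\<lambda>x. \<integral>y. norm (k x y) \<partial>\<nu>)"
  proof (rule Bochner_Integration.integrable_bound)
    show "integrable torus (\<lambda>x. (C * W 1) * rep_torus_L2 g x)"
      by (intro integrable_mult_right integrable_rep)
    show "(\<lambda>x. \<integral>y. norm (k x y) \<partial>\<nu>) \<in> borel_measurable torus"
      using k_meas by (intro \<nu>.borel_measurable_lebesgue_integral) (simp add: case_prod_beta')
    have "norm (\<integral>y. norm (k x y) \<partial>\<nu>) \<le> norm ((C * W 1) * rep_torus_L2 g x)" for x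
    proof -
      have "(\<integral>y. norm (k x y) \<partial>\<nu>) \<le> (\<integral>y. \<bar>rep_torus_L2 g x\<bar> * C \<partial>\<nu>)"
      proof (rule integral_mono)
        fix y assume "y \<in> space \<nu>"
        then show "norm (k x y) \<le> \<bar>rep_torus_L2 g x\<bar> * C"
          using C[of y] by (auto simp: k_def abs_mult intro!: mult_left_mono)
      qed (use row in auto)
      also have "\<dots> = \<bar>rep_torus_L2 g x\<bar> * C * W 1"
        by (simp add: mult_ac)
      finally show ?thesis
        using W_1_pos C[of 0] by (simp add: abs_mult mult_ac)
    qed
    then show "AE x in torus. norm (\<integral>y. norm (k x y) \<partial>\<nu>) \<le> norm ((C * W 1) * rep_torus_L2 g x)"
      by simp
  qed
  then have "integrable (torus \<Otimes>\<^sub>M \<nu>) (\<lambda>(x, y). k x y)"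
    using row by (intro Fubini_integrable k_meas) auto
  then have "(\<integral>y. (\<integral>x. k x y \<partial>torus) \<partial>\<nu>) = (\<integral>x. (\<integral>y. k x y \<partial>\<nu>) \<partial>torus)"
    by (rule Fubini_integral)
  moreover have "(\<integral>y. k x y \<partial>\<nu>) = rep_torus_L2 g x * W_integral v x" for x
    by (simp add: k_def W_integral_def)
  moreover have column: "(\<integral>x. k x y \<partial>torus) = v y * (primitive g 1 - primitive g y)" if "y \<in> {0<..1}" for y
  proof -
    have "primitive g 1 - primitive g y = (LINT x:{y..<1}|lborel. rep_torus_L2 g x)"
      using that by (simp add: primitive_diff_eq_inner inner_indicator_class)
    moreover have "(\<integral>x. k x y \<partial>torus) = (\<integral>x. v y * (indicator {y..<1} x * rep_torus_L2 g x) \<partial>lborel)"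
      unfolding integral_torus k_def
      using that by (intro Bochner_Integration.integral_cong) (auto simp: indicator_def)
    ultimately show ?thesis
      by (simp add: set_lebesgue_integral_def)
  qed
  then have "(\<integral>y. (\<integral>x. k x y \<partial>torus) \<partial>\<nu>) = (\<integral>y. v y * (primitive g 1 - primitive g y) \<partial>\<nu>)"
    by (intro Bochner_Integration.integral_cong) (auto simp: column)
  ultimately show ?thesis by simp
qed

section \<open>The graph of the generalized derivative\<close>

text \<open>The function \<open>b + \<integral>\<^sub>0\<^sup>y g\<close> for the only \<open>b\<close> that satisfies the second boundary condition
  (\<open>velocity_unique\<close>).\<close>

definition velocity :: "torus_L2 \<Rightarrow> real \<Rightarrow> real" where
  "velocity g y = primitive g y - (\<integral>z. primitive g z \<partial>\<nu>) / W 1"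

lemma continuous_on_velocity: "continuous_on {0..1} (velocity g)"
  unfolding velocity_def[abs_def] by (intro continuous_intros continuous_on_primitive)

lemma integral_velocity: "(\<integral>y. velocity g y \<partial>\<nu>) = 0"
  unfolding velocity_def
  using W_1_pos integrable_\<nu>[OF continuous_on_primitive] by simp

lemma velocity_add: "y \<le> 1 \<Longrightarrow> velocity (g + h) y = velocity g y + velocity h y"
proof -
  have "(\<integral>z. primitive (g + h) z \<partial>\<nu>) = (\<integral>z. primitive g z + primitive h z \<partial>\<nu>)"
    by (intro Bochner_Integration.integral_cong) (auto simp: primitive_add)
  also have "\<dots> = (\<integral>z. primitive g z \<partial>\<nu>) + (\<integral>z. primitive h z \<partial>\<nu>)"
    by (intro Bochner_Integration.integral_add integrable_\<nu> continuous_on_primitive)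
  finally show "y \<le> 1 \<Longrightarrow> velocity (g + h) y = velocity g y + velocity h y"
    by (simp add: velocity_def primitive_add add_divide_distrib)
qed

lemma velocity_scale: "y \<le> 1 \<Longrightarrow> velocity (c *\<^sub>R g) y = c * velocity g y"
proof -
  have "(\<integral>z. primitive (c *\<^sub>R g) z \<partial>\<nu>) = (\<integral>z. c * primitive g z \<partial>\<nu>)"
    by (intro Bochner_Integration.integral_cong) (auto simp: primitive_scale)
  then show "y \<le> 1 \<Longrightarrow> velocity (c *\<^sub>R g) y = c * velocity g y"
    by (simp add: velocity_def primitive_scale algebra_simps)
qed

lemma velocity_bound:
  assumes C: "\<And>y. y \<in> {0..1} \<Longrightarrow> \<bar>primitive g y\<bar> \<le> C" and "y \<in> {0..1}"
  shows "\<bar>velocity g y\<bar> \<le> 2 * C"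
proof -
  have "\<bar>\<integral>z. primitive g z \<partial>\<nu>\<bar> \<le> C * W 1"
    using W_integral_bound[OF continuous_on_primitive C, where x = 1] by (simp add: W_integral_1)
  then have "\<bar>(\<integral>z. primitive g z \<partial>\<nu>) / W 1\<bar> \<le> C"
    using W_1_pos by (simp add: abs_divide divide_le_eq)
  then show ?thesis
    using C[OF \<open>y \<in> {0..1}\<close>] unfolding velocity_def by linarith
qed

lemma W_integral_velocity_1: "W_integral (velocity g) 1 = 0"
  by (simp add: W_integral_1 integral_velocity)

lemma velocity_unique:
  assumes "W_integral (\<lambda>y. b + primitive g y) 1 = 0"
  shows "(\<lambda>y. b + primitive g y) = velocity g"
proof -
  have "b * W 1 + (\<integral>z. primitive g z \<partial>\<nu>) = 0"
    using assms integrable_\<nu>[OF continuous_on_primitive] by (simp add: W_integral_1 mult.commute)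
  then have "b = - (\<integral>z. primitive g z \<partial>\<nu>) / W 1"
    using W_1_pos by (simp add: field_simps)
  then show ?thesis
    by (simp add: velocity_def fun_eq_iff)
qed

definition potential :: "torus_L2 \<Rightarrow> torus_L2" where
  "potential g = abs_torus_L2 (W_integral (velocity g))"

lemma rep_potential: "AE x in torus. rep_torus_L2 (potential g) x = W_integral (velocity g) x"
  unfolding potential_def by (intro rep_abs square_integrable_W_integral continuous_on_velocity)

lemma W_integral_cong: "(\<And>y. y \<in> {0<..1} \<Longrightarrow> v y = w y) \<Longrightarrow> W_integral v x = W_integral w x"
  unfolding W_integral_def by (intro Bochner_Integration.integral_cong) auto

text \<open>The bound by the supremum of the primitive, rather than by the norm of \<open>g\<close>, is what turns
  uniform convergence of primitives into convergence of potentials.\<close>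

lemma norm_potential_le:
  assumes C: "\<And>y. y \<in> {0..1} \<Longrightarrow> \<bar>primitive g y\<bar> \<le> C"
  shows "norm (potential g) \<le> 2 * C * W 1"
proof (rule norm_le_AE_bound)
  show "0 \<le> 2 * C * W 1"
    using C[of 0] W_1_pos by simp
  have "\<bar>W_integral (velocity g) x\<bar> \<le> 2 * C * W 1" for x
    by (intro W_integral_bound continuous_on_velocity velocity_bound C)
  then show "AE x in torus. \<bar>rep_torus_L2 (potential g) x\<bar> \<le> 2 * C * W 1"
    using rep_potential[of g] by auto
qed

lemma bounded_linear_potential: "bounded_linear potential"
proof
  show "potential (g + h) = potential g + potential h" for g h
  proof (rule torus_L2_eqI)
    have W_integral_eq: "W_integral (velocity (g + h)) x = W_integral (velocity g) x + W_integral (velocity h) x" for x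
      unfolding W_integral_add[OF continuous_on_velocity continuous_on_velocity, symmetric]
      by (rule W_integral_cong) (simp add: velocity_add)
    show "AE x in torus. rep_torus_L2 (potential (g + h)) x = rep_torus_L2 (potential g + potential h) x"
      using rep_potential[of "g + h"] rep_potential[of g] rep_potential[of h]
        rep_add[of "potential g" "potential h"]
      by eventually_elim (simp add: W_integral_eq)
  qed
  show "potential (c *\<^sub>R g) = c *\<^sub>R potential g" for c g
  proof (rule torus_L2_eqI)
    have W_integral_eq: "W_integral (velocity (c *\<^sub>R g)) x = c * W_integral (velocity g) x" for x
      unfolding W_integral_scale[symmetric] by (rule W_integral_cong) (simp add: velocity_scale)
    show "AE x in torus. rep_torus_L2 (potential (c *\<^sub>R g)) x = rep_torus_L2 (c *\<^sub>R potential g) x"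
      using rep_potential[of "c *\<^sub>R g"] rep_potential[of g] rep_scale[of c "potential g"]
      by eventually_elim (simp add: W_integral_eq)
  qed
  have "norm (potential g) \<le> norm g * (2 * W 1)" for g
    using norm_potential_le[OF primitive_bound, of g] by (simp add: mult_ac)
  then show "\<exists>K. \<forall>g. norm (potential g) \<le> norm g * K"
    by blast
qed

sublocale potential: bounded_linear potential
  by (rule bounded_linear_potential)

text \<open>Given the first boundary condition, the second one leaves the additive constant \<open>a\<close> as the
  only freedom.\<close>

lemma LW_graph_iff:
  "LW_graph W f g \<longleftrightarrow> inner g torus_one = 0 \<and> (\<exists>a. f = a *\<^sub>R torus_one + potential g)"
proof -
  have class_eq: "f = a *\<^sub>R torus_one + potential g \<longleftrightarrow>
      (AE x in torus. rep_torus_L2 f x = a + W_integral (velocity g) x)" for a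
  proof -
    have rep: "AE x in torus. rep_torus_L2 (a *\<^sub>R torus_one + potential g) x = a + W_integral (velocity g) x"
      using rep_add[of "a *\<^sub>R torus_one" "potential g"] rep_scale[of a torus_one] rep_torus_one rep_potential[of g]
      by eventually_elim simp
    show ?thesis
    proof
      assume "AE x in torus. rep_torus_L2 f x = a + W_integral (velocity g) x"
      then have "AE x in torus. rep_torus_L2 f x = rep_torus_L2 (a *\<^sub>R torus_one + potential g) x"
        using rep by eventually_elim simp
      then show "f = a *\<^sub>R torus_one + potential g" by (rule torus_L2_eqI)
    qed (use rep in simp)
  qed
  have integrand_eq: "a + b * W x + (LINT y:{0<..x}|interval_measure W. primitive g y)
      = a + W_integral (\<lambda>y. b + primitive g y) x" if "x \<in> space torus" for a b x
  proof -
    have "b * W x = W_integral (\<lambda>y. b) x"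
      using that by (simp add: W_integral_const)
    then show ?thesis
      using that by (simp add: set_integral_eq_W_integral W_integral_add continuous_on_primitive)
  qed
  have "(AE x in torus. rep_torus_L2 f x = a + b * W x + (LINT y:{0<..x}|interval_measure W. primitive g y))
      \<longleftrightarrow> (AE x in torus. rep_torus_L2 f x = a + W_integral (\<lambda>y. b + primitive g y) x)" for a b
    by (rule AE_cong) (simp only: integrand_eq)
  then have "LW_graph W f g \<longleftrightarrow> inner g torus_one = 0 \<and> (\<exists>a b.
      (AE x in torus. rep_torus_L2 f x = a + W_integral (\<lambda>y. b + primitive g y) x) \<and>
      W_integral (\<lambda>y. b + primitive g y) 1 = 0)"
    unfolding LW_graph_def by (simp add: set_integral_eq_W_integral primitive_1) blast
  also have "\<dots> \<longleftrightarrow> inner g torus_one = 0 \<and> (\<exists>a. AE x in torus. rep_torus_L2 f x = a + W_integral (velocity g) x)"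
  proof -
    have "(\<exists>b. (AE x in torus. rep_torus_L2 f x = a + W_integral (\<lambda>y. b + primitive g y) x) \<and>
        W_integral (\<lambda>y. b + primitive g y) 1 = 0)
      \<longleftrightarrow> (AE x in torus. rep_torus_L2 f x = a + W_integral (velocity g) x)" (is "?L \<longleftrightarrow> ?R") for a
    proof
      assume ?L then show ?R
        using velocity_unique by metis
    next
      assume ?R
      moreover have "velocity g = (\<lambda>y. - (\<integral>z. primitive g z \<partial>\<nu>) / W 1 + primitive g y)"
        by (simp add: velocity_def fun_eq_iff)
      ultimately show ?L
        using W_integral_velocity_1[of g] by metis
    qed
    then show ?thesis by blast
  qed
  finally show ?thesis by (simp only: class_eq)
qed

text \<open>The Dirichlet form of the operator. The mean zero condition removes the boundary term at \<open>1\<close>,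
  and \<open>velocity h\<close> having mean zero permits replacing the primitive of \<open>g\<close> by its velocity.\<close>

lemma inner_potential:
  assumes "inner g torus_one = 0"
  shows "inner g (potential h) = - (\<integral>y. velocity g y * velocity h y \<partial>\<nu>)"
proof -
  let ?m = "(\<integral>z. primitive g z \<partial>\<nu>) / W 1"
  have "inner g (potential h) = (\<integral>x. rep_torus_L2 g x * W_integral (velocity h) x \<partial>torus)"
    using inner_abs[OF square_integrable_rep square_integrable_W_integral[OF continuous_on_velocity], of g h]
    by (simp add: potential_def)
  also have "\<dots> = (\<integral>y. velocity h y * (primitive g 1 - primitive g y) \<partial>\<nu>)"
    by (rule integral_mult_W_integral[OF continuous_on_velocity])
  also have "\<dots> = (\<integral>y. - (velocity g y * velocity h y) - ?m * velocity h y \<partial>\<nu>)"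
    using assms by (intro Bochner_Integration.integral_cong)
      (auto simp: primitive_1 velocity_def algebra_simps)
  also have "\<dots> = (\<integral>y. - (velocity g y * velocity h y) \<partial>\<nu>) - (\<integral>y. ?m * velocity h y \<partial>\<nu>)"
    by (intro Bochner_Integration.integral_diff integrable_\<nu> continuous_intros continuous_on_velocity)
  also have "\<dots> = - (\<integral>y. velocity g y * velocity h y \<partial>\<nu>)"
    by (simp add: integral_velocity)
  finally show ?thesis .
qed

lemma potential_nonpositive: "inner g torus_one = 0 \<Longrightarrow> inner g (potential g) \<le> 0"
  by (simp add: inner_potential)

text \<open>If \<open>v\<close> were nonzero at an interior point, \<open>v\<^sup>2\<close> would exceed a positive constant on an
  interval, which has positive mass because \<open>W\<close> increases strictly. The end points follow by
  continuity.\<close>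

lemma continuous_eq_0_if_integral_square_0:
  assumes v: "continuous_on {0..1} v" and int: "(\<integral>y. v y * v y \<partial>\<nu>) = 0" and "y \<in> {0..1}"
  shows "v y = (0::real)"
proof -
  have open_zero: "v y = 0" if y: "y \<in> {0<..<1}" for y
  proof (rule ccontr)
    assume "v y \<noteq> 0"
    define s where "s = \<bar>v y\<bar> / 2"
    have "s > 0" using \<open>v y \<noteq> 0\<close> by (simp add: s_def)
    obtain d where d: "d > 0" "\<And>z. z \<in> {0..1} \<Longrightarrow> \<bar>z - y\<bar> < d \<Longrightarrow> \<bar>v z - v y\<bar> < s"
      using v y \<open>s > 0\<close> unfolding continuous_on_iff dist_real_def
      by (metis atLeastAtMost_iff greaterThanLessThan_iff less_imp_le)
    define p q where "p = max 0 (y - d / 2)" and "q = min 1 (y + d / 2)"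
    have pq: "0 \<le> p" "p < q" "q \<le> 1"
      using y d(1) by (auto simp: p_def q_def)
    have lower: "s\<^sup>2 \<le> v z * v z" if "z \<in> {p<..q}" for z
    proof -
      have "z \<in> {0..1}" "\<bar>z - y\<bar> < d"
        using that pq d(1) by (auto simp: p_def q_def)
      then have "\<bar>v z - v y\<bar> < s" by (rule d)
      then have "s \<le> \<bar>v z\<bar>" unfolding s_def by arith
      then have "s\<^sup>2 \<le> \<bar>v z\<bar>\<^sup>2"
        using \<open>s > 0\<close> by (intro power_mono) auto
      then show ?thesis by (simp add: power2_eq_square)
    qed
    have "s\<^sup>2 * (W q - W p) = (\<integral>z. s\<^sup>2 * indicator {p<..q} z \<partial>\<nu>)"
      using pq by (simp add: measure_\<nu> Int_absorb2)
    also have "\<dots> \<le> (\<integral>z. v z * v z \<partial>\<nu>)"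
    proof (rule integral_mono)
      show "integrable \<nu> (\<lambda>z. s\<^sup>2 * indicator {p<..q} z)"
        using pq by (intro integrable_mult_right integrable_real_indicator) (auto simp: less_top[symmetric])
      show "integrable \<nu> (\<lambda>z. v z * v z)"
        by (intro integrable_\<nu> continuous_intros v)
      show "s\<^sup>2 * indicator {p<..q} z \<le> v z * v z" for z
        using lower[of z] by (auto simp: indicator_def)
    qed
    also have "\<dots> = 0" by (rule int)
    finally have "s\<^sup>2 * (W q - W p) \<le> 0" .
    moreover have "s\<^sup>2 * (W q - W p) > 0"
      using \<open>s > 0\<close> strict_monoD[OF W_strict_mono pq(2)] by simp
    ultimately show False by simp
  qed
  have "closure {0<..<1::real} = {0..1}" by simp
  then show ?thesis
    using continuous_constant_on_closure[of "{0<..<1}" v 0 y] v open_zero \<open>y \<in> {0..1}\<close> by simp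
qed

text \<open>The velocity vanishes on \<open>{0..1}\<close>, so the primitive is constant there; it starts at \<open>0\<close>.\<close>

lemma potential_definite:
  assumes "inner g torus_one = 0" "inner g (potential g) = 0"
  shows "g = 0"
proof (rule primitive_eq_0_imp)
  fix y :: real assume y: "y \<in> {0..1}"
  have "(\<integral>y. velocity g y * velocity g y \<partial>\<nu>) = 0"
    using inner_potential[OF assms(1), of g] assms(2) by simp
  then have v: "velocity g z = 0" if "z \<in> {0..1}" for z
    using continuous_eq_0_if_integral_square_0[OF continuous_on_velocity _ that] by blast
  show "primitive g y = 0"
    using v[of 0] v[OF y] by (simp add: velocity_def)
qed

text \<open>The difference of two values has a constant potential, to which it is orthogonal.\<close>

lemma LW_graph_functional:
  assumes "LW_graph W f g" "LW_graph W f h"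
  shows "g = h"
proof -
  obtain a where a: "f = a *\<^sub>R torus_one + potential g"
    using assms(1) by (auto simp: LW_graph_iff)
  obtain b where b: "f = b *\<^sub>R torus_one + potential h"
    using assms(2) by (auto simp: LW_graph_iff)
  have ortho: "inner (g - h) torus_one = 0"
    using assms by (simp add: LW_graph_iff inner_diff_left)
  have "potential g - potential h = b *\<^sub>R torus_one - a *\<^sub>R torus_one"
    using a b by (metis add_diff_cancel_left' add_diff_eq diff_add_eq diff_diff_eq2)
  then have "potential (g - h) = (b - a) *\<^sub>R torus_one"
    by (simp add: potential.diff algebra_simps)
  then have "inner (g - h) (potential (g - h)) = 0"
    using ortho by simp
  then show "g = h"
    using potential_definite[OF ortho] by simp
qed

lemma LW_eq: "LW_graph W f g \<Longrightarrow> LW W f = g"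
  unfolding LW_def using LW_graph_functional by blast

lemma in_DW_iff: "f \<in> DW W \<longleftrightarrow> LW_graph W f (LW W f)"
  unfolding DW_def using LW_eq by auto

lemma LW_graph_I: "inner g torus_one = 0 \<Longrightarrow> LW_graph W (a *\<^sub>R torus_one + potential g) g"
  by (auto simp: LW_graph_iff)

lemma DW_E:
  assumes "f \<in> DW W"
  obtains a g where "f = a *\<^sub>R torus_one + potential g" "inner g torus_one = 0" "LW W f = g"
  using assms unfolding in_DW_iff LW_graph_iff by blast

section \<open>Resolvent and spectrum\<close>

lemma potential_compact:
  assumes B: "\<And>n. norm (g n) \<le> B"
  obtains k :: "nat \<Rightarrow> nat" and p where "strict_mono k" "(\<lambda>n. potential (g (k n))) \<longlonglongrightarrow> p"
proof -
  obtain k :: "nat \<Rightarrow> nat" and G where k: "strict_mono k"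
    and G: "\<And>e. 0 < e \<Longrightarrow> \<exists>N. \<forall>n\<ge>N. \<forall>y\<in>{0..1}. \<bar>primitive (g (k n)) y - G y\<bar> < e"
    by (rule primitive_uniformly_convergent_subseq[OF B]) (rule that)
  have "Cauchy (\<lambda>n. potential (g (k n)))"
  proof (rule metric_CauchyI)
    fix e :: real assume "0 < e"
    \<comment> \<open>Primitives \<open>2 c\<close> apart have potentials at most \<open>4 c W(1) < e\<close> apart.\<close>
    define c where "c = e / (5 * W 1)"
    have "0 < c" using \<open>0 < e\<close> W_1_pos by (simp add: c_def)
    then obtain N where N: "\<And>n y. n \<ge> N \<Longrightarrow> y \<in> {0..1} \<Longrightarrow> \<bar>primitive (g (k n)) y - G y\<bar> < c"
      using G by meson
    have "dist (potential (g (k m))) (potential (g (k n))) < e" if mn: "m \<ge> N" "n \<ge> N" for m n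
    proof -
      have "\<bar>primitive (g (k m) - g (k n)) y\<bar> \<le> 2 * c" if y: "y \<in> {0..1}" for y
      proof -
        have "primitive (g (k m) - g (k n)) y = primitive (g (k m)) y - primitive (g (k n)) y"
          using y by (simp add: primitive_eq_inner inner_diff_left)
        then show ?thesis
          using N[OF mn(1) y] N[OF mn(2) y] by linarith
      qed
      then have "norm (potential (g (k m) - g (k n))) \<le> 2 * (2 * c) * W 1"
        by (rule norm_potential_le)
      also have "\<dots> < e"
        using \<open>0 < e\<close> W_1_pos by (simp add: c_def)
      finally show ?thesis
        by (simp add: dist_norm potential.diff)
    qed
    then show "\<exists>M. \<forall>m\<ge>M. \<forall>n\<ge>M. dist (potential (g (k m))) (potential (g (k n))) < e"
      by blast
  qed
  then obtain p where "(\<lambda>n. potential (g (k n))) \<longlonglongrightarrow> p"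
    using Cauchy_convergent convergentD by blast
  with k show thesis by (rule that)
qed

text \<open>With the projection \<open>c\<close> onto functions of mean zero, \<open>K = - c \<circ> potential \<circ> c\<close> is the
  inverse of the negative operator on that subspace and vanishes on constants. If
  \<open>x + K x = c h\<close>, then \<open>x\<close> has mean zero and \<open>f = \<langle>h, 1\<rangle> + K x\<close> satisfies \<open>L f = - x\<close>, so
  \<open>f - L f = h\<close>.\<close>

lemma LW_resolvent_exists: "\<exists>f\<in>DW W. f - LW W f = h"
proof -
  define c where "c x = x - inner x torus_one *\<^sub>R torus_one" for x
  define K where "K x = - c (potential (c x))" for x
  have c_bl: "bounded_linear c"
    unfolding c_def[abs_def]
    by (intro bounded_linear_sub bounded_linear_ident bounded_linear_compose[OF bounded_linear_scaleR_left] bounded_linear_inner_left)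
  have c_one: "inner (c x) torus_one = 0" for x
    by (simp add: c_def inner_diff_left)
  have "bounded_linear K"
    unfolding K_def[abs_def]
    by (intro bounded_linear_minus bounded_linear_compose[OF c_bl]
        bounded_linear_compose[OF bounded_linear_potential] c_bl)
  moreover have "0 \<le> inner (K x) x" for x
  proof -
    have "inner (K x) x = - inner (c x) (potential (c x))"
      by (simp add: K_def c_def inner_diff inner_commute algebra_simps)
    then show ?thesis
      using potential_nonpositive[OF c_one, of x] by simp
  qed
  ultimately obtain x where x: "x + K x = c h"
    using identity_plus_monotone_surj by blast
  have "inner x torus_one = inner (c h - K x) torus_one"
    by (simp flip: x)
  also have "\<dots> = 0"
    by (simp add: inner_diff_left inner_add_left K_def c_one)
  finally have x_one: "inner x torus_one = 0" .
  define f where "f = inner h torus_one *\<^sub>R torus_one + K x"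
  have "f = (inner h torus_one + inner (potential x) torus_one) *\<^sub>R torus_one + potential (- x)"
    by (simp add: f_def K_def x_one c_def potential.neg algebra_simps)
  then have graph: "LW_graph W f (- x)"
    using LW_graph_I[of "- x"] x_one by simp
  have "f - LW W f = inner h torus_one *\<^sub>R torus_one + (x + K x)"
    unfolding LW_eq[OF graph] by (simp add: f_def)
  also have "\<dots> = h"
    unfolding x by (simp add: c_def)
  finally show ?thesis
    using graph by (auto simp: DW_def)
qed

text \<open>For compactness, write a sequence in the domain as \<open>a n + potential (g n)\<close>: the potentials
  have a convergent subsequence, and along it the constants \<open>a n\<close> remain bounded.\<close>

sublocale LW: nonpositive_operator_compact_resolvent "DW W" "LW W"
proof
  have graph_add: "LW_graph W (f + f') (g + g')" if fg: "LW_graph W f g" "LW_graph W f' g'" for f f' g g'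
  proof -
    obtain a where "f = a *\<^sub>R torus_one + potential g" using fg(1) by (auto simp: LW_graph_iff)
    moreover obtain a' where "f' = a' *\<^sub>R torus_one + potential g'" using fg(2) by (auto simp: LW_graph_iff)
    ultimately have "f + f' = (a + a') *\<^sub>R torus_one + potential (g + g')"
      by (simp add: potential.add algebra_simps)
    then show ?thesis
      using fg LW_graph_I[of "g + g'" "a + a'"] by (simp add: LW_graph_iff inner_add_left)
  qed
  have graph_scale: "LW_graph W (c *\<^sub>R f) (c *\<^sub>R g)" if fg: "LW_graph W f g" for c f g
  proof -
    obtain a where "f = a *\<^sub>R torus_one + potential g" using fg by (auto simp: LW_graph_iff)
    then have "c *\<^sub>R f = (c * a) *\<^sub>R torus_one + potential (c *\<^sub>R g)"
      by (simp add: potential.scale algebra_simps)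
    then show ?thesis
      using fg LW_graph_I[of "c *\<^sub>R g" "c * a"] by (simp add: LW_graph_iff)
  qed
  show "subspace (DW W)"
  proof (rule subspaceI)
    show "0 \<in> DW W"
      using LW_graph_I[of 0 0] by (auto simp: DW_def potential.zero)
  qed (use graph_add graph_scale in \<open>auto simp: DW_def; blast\<close>)+
  show "LW W (f + g) = LW W f + LW W g" if "f \<in> DW W" "g \<in> DW W" for f g
    using that by (intro LW_eq graph_add) (simp_all add: in_DW_iff)
  show "LW W (c *\<^sub>R f) = c *\<^sub>R LW W f" if "f \<in> DW W" for c f
    using that by (intro LW_eq graph_scale) (simp add: in_DW_iff)
  show "inner (LW W f) f' = inner f (LW W f')" if "f \<in> DW W" "f' \<in> DW W" for f f'
  proof -
    obtain a g where f: "f = a *\<^sub>R torus_one + potential g" "inner g torus_one = 0" "LW W f = g"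
      using \<open>f \<in> DW W\<close> by (rule DW_E)
    obtain a' g' where f': "f' = a' *\<^sub>R torus_one + potential g'" "inner g' torus_one = 0" "LW W f' = g'"
      using \<open>f' \<in> DW W\<close> by (rule DW_E)
    have "inner g f' = inner g (potential g')"
      using f by (simp add: f'(1) inner_add_right)
    also have "\<dots> = inner g' (potential g)"
      using f f' by (simp add: inner_potential mult.commute)
    also have "\<dots> = inner f g'"
      using f' by (simp add: f(1) inner_add_right inner_commute[of _ g'])
    finally show ?thesis using f f' by simp
  qed
  show "0 \<le> inner (- LW W f) f" if "f \<in> DW W" for f
  proof -
    obtain a g where f: "f = a *\<^sub>R torus_one + potential g" "inner g torus_one = 0" "LW W f = g"
      using \<open>f \<in> DW W\<close> by (rule DW_E)
    have "inner (- LW W f) f = - inner g (potential g)"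
      using f(2) by (simp add: f(3)) (simp add: f(1) inner_add_right)
    then show ?thesis
      using potential_nonpositive[OF f(2)] by simp
  qed
  show "\<exists>f\<in>DW W. f - LW W f = h" for h
    by (rule LW_resolvent_exists)
  show "\<exists>r l. strict_mono r \<and> (\<lambda>n. X (r n)) \<longlonglongrightarrow> l"
    if X: "\<And>n. X n \<in> DW W" and bX: "bounded (range X)" and bL: "bounded (range (\<lambda>n. LW W (X n)))"
    for X :: "nat \<Rightarrow> torus_L2"
  proof -
    define g where "g n = LW W (X n)" for n
    obtain B where B: "\<And>n. norm (g n) \<le> B"
      using bL unfolding bounded_iff g_def by auto
    obtain B' where B': "\<And>n. norm (X n) \<le> B'"
      using bX unfolding bounded_iff by auto
    have "\<exists>a. X n = a *\<^sub>R torus_one + potential (g n)" for n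
      using DW_E[OF X[of n]] unfolding g_def by metis
    then obtain a where a: "\<And>n. X n = a n *\<^sub>R torus_one + potential (g n)"
      by metis
    obtain k p where k: "strict_mono (k :: nat \<Rightarrow> nat)" "(\<lambda>n. potential (g (k n))) \<longlonglongrightarrow> p"
      by (rule potential_compact[OF B]) (rule that)
    have "bounded (range (\<lambda>n. a (k n)))"
    proof -
      have "bounded (range (\<lambda>n. potential (g (k n))))"
        using k(2) by (rule convergent_imp_bounded)
      then obtain C where C: "\<And>n. norm (potential (g (k n))) \<le> C"
        unfolding bounded_iff by auto
      have "norm (a (k n)) \<le> B' + C" for n
      proof -
        have "norm (a (k n)) = norm (X (k n) - potential (g (k n)))"
          by (simp add: a[of "k n"])
        also have "\<dots> \<le> B' + C"
          using norm_triangle_ineq4[of "X (k n)" "potential (g (k n))"] B'[of "k n"] C[of n] by linarith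
        finally show ?thesis .
      qed
      then show ?thesis by (auto simp: bounded_iff)
    qed
    then obtain l j where j: "strict_mono (j :: nat \<Rightarrow> nat)" "((\<lambda>n. a (k n)) \<circ> j) \<longlonglongrightarrow> l"
      using bounded_imp_convergent_subsequence by blast
    have "(\<lambda>n. a (k (j n)) *\<^sub>R torus_one + potential (g (k (j n)))) \<longlonglongrightarrow> l *\<^sub>R torus_one + p"
      using j(2) LIMSEQ_subseq_LIMSEQ[OF k(2) j(1)] by (intro tendsto_intros) (simp_all add: o_def)
    then have "(\<lambda>n. X ((k \<circ> j) n)) \<longlonglongrightarrow> l *\<^sub>R torus_one + p"
      by (simp add: a)
    then show ?thesis
      using strict_mono_o[OF k(1) j(1)] by blast
  qed
qed

lemma torus_one_in_kernel: "torus_one \<in> DW W" "LW W torus_one = 0" "torus_one \<noteq> 0"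
proof -
  have "LW_graph W torus_one 0"
    using LW_graph_I[of 0 1] by (simp add: potential.zero)
  then show "torus_one \<in> DW W" "LW W torus_one = 0"
    by (auto simp: DW_def LW_eq)
  show "torus_one \<noteq> 0"
    by (metis norm_torus_one norm_zero zero_neq_one)
qed

end

theorem theorem2p1:
  fixes W :: "real \<Rightarrow> real"
  assumes "strict_mono W"
    and "\<And>u. continuous (at_right u) W"
    and "\<And>u. \<exists>l. (W \<longlongrightarrow> l) (at_left u)"
    and "\<And>u. W (u + 1) - W u = W 1 - W 0"
    and "W 0 = 0"
  shows "closure (DW W) = UNIV
    \<and> bij_betw (\<lambda>f. f - LW W f) (DW W) UNIV
    \<and> (self_adjoint (DW W) (LW W) \<and> (\<forall>f\<in>DW W. inner (- LW W f) f \<ge> 0))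
    \<and> dissipative (DW W) (LW W)
    \<and> (\<exists>lam :: nat \<Rightarrow> real.
         (eigenvalues (DW W) (\<lambda>f. - LW W f) = range lam
          \<and> (\<forall>c\<in>range lam. finite_dimensional (eigenspace (DW W) (\<lambda>f. - LW W f) c)
                \<and> card {n. lam n = c} = dim (eigenspace (DW W) (\<lambda>f. - LW W f) c))
          \<and> lam 0 = 0 \<and> incseq lam \<and> filterlim lam at_top sequentially)
         \<and> (\<exists>f :: nat \<Rightarrow> torus_L2.
              (\<forall>n. f n \<in> eigenspace (DW W) (\<lambda>f. - LW W f) (lam n))
              \<and> complete_orthonormal_seq f))"
proof -
  interpret stieltjes_weight W
    using assms by unfold_locales
  show ?thesis
  proof (rule LW.discrete_spectrum[OF torus_L2_infinite_dimensional torus_one_in_kernel(1,3,2)])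
    fix lam :: "nat \<Rightarrow> real" and e :: "nat \<Rightarrow> torus_L2"
    assume e: "complete_orthonormal_seq e" "\<And>n. e n \<in> eigenspace (DW W) (\<lambda>f. - LW W f) (lam n)"
      and lam: "eigenvalues (DW W) (\<lambda>f. - LW W f) = range lam"
        "\<And>c. finite_dimensional (eigenspace (DW W) (\<lambda>f. - LW W f) c)"
        "\<And>c. card {n. lam n = c} = dim (eigenspace (DW W) (\<lambda>f. - LW W f) c)"
        "lam 0 = 0" "incseq lam" "filterlim lam at_top sequentially"
    have "range e \<subseteq> DW W"
      using e(2) by (auto simp: eigenspace_def)
    then have "span (range e) \<subseteq> DW W"
      by (rule span_minimal[OF _ LW.subspace])
    then have "closure (span (range e)) \<subseteq> closure (DW W)"
      by (rule closure_mono)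
    then have dense: "closure (DW W) = UNIV"
      using e(1) by (auto simp: complete_orthonormal_seq_def)
    show ?thesis
      using dense LW.resolvent_bij LW.self_adjoint_operator[OF dense] LW.nonpositive
        LW.dissipative_operator lam e
      by (intro conjI ballI exI[of _ lam] exI[of _ e] allI) simp_all
  qed
qed

end
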